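(* Let $q\in(0,1)$. If $\mathcal{X}\subseteq\mathrm{Lip}_q(S^1)$ is an operator subsystem with $\mathcal{O}(S^1)\subseteq\mathcal{X}$, then the quantum metric $(\mathcal{X},L_q)$ on $C(S^1)$ does not come from a metric on $S^1$.
   Context: **$q$-integers.** For $q\in(0,1)$ and $n\in\mathbb{Z}$ put $[n]_q := \frac{q^n-q^{-n}}{q-q^{-1}}$. **Identification of $C(S^1)$.** $\ell^2(\mathbb{Z})$ has standard orthonormal basis $(e_j)_{j\in\mathbb{Z}}$, inner products are linear in the second variable, and $\|\cdot\|_\infty$ denotes the operator norm (the supremum norm on $C(S^1)$). For a bounded operator $T$ on $\ell^2(\mathbb{Z})$ write $T_{jk} := \langle e_j, Te_k\rangle$. Let $U$ be the bilateral shift, $U e_j = e_{j+1}$. The $C^*$-algebra $C(S^1)$ is identified with $C^*(U)\subseteq \mathbb{B}(\ell^2(\mathbb{Z}))$ via $z\mapsto U$, where $z:S^1\to\mathbb{C}$ is the inclusion. $\mathcal{O}(S^1)\subseteq C(S^1)$ is the linear span of $\{z^n : n\in\mathbb{Z}\}$. **$q$-derivative.** $\mathrm{Lip}_q(\ell^2(\mathbb{Z}))$ is the set of bounded operators $T$ on $\ell^2(\mathbb{Z})$ such that the infinite matrix $(i[j-k]_q T_{jk})_{j,k\in\mathbb{Z}}$ is the matrix of a bounded operator; this bounded operator is denoted $\mathrm{d}_q(T)$. Put $\mathrm{Lip}_q(S^1) := C(S^1)\cap \mathrm{Lip}_q(\ell^2(\mathbb{Z}))$ and $L_q(T):=\|\mathrm{d}_q(T)\|_\infty$.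 An operator subsystem of $\mathrm{Lip}_q(S^1)$ is a (not necessarily closed) $*$-invariant subspace containing $1$. **Quantum metrics.** For an operator subsystem $\mathcal{X}\subseteq \mathrm{Lip}_q(S^1)$ which is dense in $C(S^1)$, that $(\mathcal{X},L_q)$ is a quantum metric on $C(S^1)$ means that $\rho(\varphi,\psi)=\sup\{|\varphi(x)-\psi(x)| : x\in\mathcal{X},\ L_q(x)\le1\}$ metrizes the weak-$*$ topology on the state space of $\mathcal{X}$; this holds for every $\mathcal{X}$ as in the claim. **Coming from a metric.** For a compact metric space $M$ with metric $\rho$, let $\mathrm{Lip}_\rho(M)\subseteq C(M)$ be the complex-valued Lipschitz functions and $L_\rho(f)$ the Lipschitz constant of $f$. A quantum metric $(\mathcal{X},L)$ on $C(M)$ comes from the metric $\rho$ if $\mathcal{X}\subseteq\mathrm{Lip}_\rho(M)$ and $L(f)=L_\rho(f)$ for all $f\in\mathcal{X}$. A metric on $S^1$ is understood to induce the usual topology of $S^1$. *)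

theory Defs
  imports "HOL-Analysis.Analysis"
begin

section \<open>The Hilbert space of square summable two-sided sequences\<close>

typedef ell2 = "{x :: int \<Rightarrow> complex. (\<lambda>j. (cmod (x j))\<^sup>2) summable_on UNIV}"
  morphisms coord Abs_ell2
  by (rule exI[of _ "\<lambda>_. 0"]) simp

setup_lifting type_definition_ell2

lemma ell2_eqI: "(\<And>j. coord x j = coord y j) \<Longrightarrow> x = y"
  by (metis coord_inject ext)

lemma summable_coord: "(\<lambda>j. (cmod (coord x j))\<^sup>2) summable_on UNIV"
  using coord[of x] by simp

lemma cmod_add_square_le: "(cmod (a + b))\<^sup>2 \<le> 2 * (cmod a)\<^sup>2 + 2 * (cmod b)\<^sup>2"
proof -
  have "(cmod (a + b))\<^sup>2 \<le> (cmod a + cmod b)\<^sup>2"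
    by (intro power_mono norm_triangle_ineq) auto
  also have "\<dots> \<le> 2 * (cmod a)\<^sup>2 + 2 * (cmod b)\<^sup>2"
    using sum_squares_bound[of "cmod a" "cmod b"] by (simp add: power2_sum)
  finally show ?thesis .
qed

lemma square_summable_add:
  assumes "(\<lambda>j. (cmod (x j))\<^sup>2) summable_on UNIV" "(\<lambda>j. (cmod (y j))\<^sup>2) summable_on UNIV"
  shows "(\<lambda>j::int. (cmod (x j + y j))\<^sup>2) summable_on UNIV"
proof (rule summable_on_comparison_test)
  show "(\<lambda>j. 2 * (cmod (x j))\<^sup>2 + 2 * (cmod (y j))\<^sup>2) summable_on UNIV"
    by (intro summable_on_add summable_on_cmult_right assms)
qed (auto simp: cmod_add_square_le)

lemma square_summable_scale:
  assumes "(\<lambda>j. (cmod (x j))\<^sup>2) summable_on UNIV"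
  shows "(\<lambda>j::int. (cmod (c * x j))\<^sup>2) summable_on UNIV"
  by (auto simp: norm_mult power_mult_distrib intro: summable_on_cmult_right assms)

lemma summable_coord_mult: "(\<lambda>j. cnj (coord x j) * coord y j) summable_on UNIV"
proof -
  have "(\<lambda>j. norm (cnj (coord x j) * coord y j)) summable_on UNIV"
  proof (rule summable_on_comparison_test)
    show "(\<lambda>j. (cmod (coord x j))\<^sup>2 + (cmod (coord y j))\<^sup>2) summable_on UNIV"
      by (intro summable_on_add summable_coord)
    show "norm (cnj (coord x j) * coord y j) \<le> (cmod (coord x j))\<^sup>2 + (cmod (coord y j))\<^sup>2" for j
      using sum_squares_bound[of "cmod (coord x j)" "cmod (coord y j)"]
        mult_nonneg_nonneg[of "cmod (coord x j)" "cmod (coord y j)"]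
      by (simp add: norm_mult del: mult_nonneg_nonneg)
  qed auto
  then show ?thesis
    by (rule abs_summable_summable)
qed

definition cinner :: "ell2 \<Rightarrow> ell2 \<Rightarrow> complex"
  where "cinner x y = (\<Sum>\<^sub>\<infinity>j. cnj (coord x j) * coord y j)"

lift_definition scaleC :: "complex \<Rightarrow> ell2 \<Rightarrow> ell2" (infixr "*\<^sub>C" 75)
  is "\<lambda>c x j. c * x j"
  by (rule square_summable_scale)

instantiation ell2 :: real_inner
begin

lift_definition zero_ell2 :: ell2 is "\<lambda>_. 0" by simp
lift_definition plus_ell2 :: "ell2 \<Rightarrow> ell2 \<Rightarrow> ell2" is "\<lambda>x y j. x j + y j"
  by (rule square_summable_add)
lift_definition uminus_ell2 :: "ell2 \<Rightarrow> ell2" is "\<lambda>x j. - x j" by simp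
definition minus_ell2 :: "ell2 \<Rightarrow> ell2 \<Rightarrow> ell2" where "minus_ell2 x y = x + - y"
definition scaleR_ell2 :: "real \<Rightarrow> ell2 \<Rightarrow> ell2" where "scaleR_ell2 r x = complex_of_real r *\<^sub>C x"
definition inner_ell2 :: "ell2 \<Rightarrow> ell2 \<Rightarrow> real" where "inner_ell2 x y = Re (cinner x y)"
definition norm_ell2 :: "ell2 \<Rightarrow> real" where "norm_ell2 x = sqrt (inner x x)"
definition sgn_ell2 :: "ell2 \<Rightarrow> ell2" where "sgn_ell2 x = inverse (norm x) *\<^sub>R x"
definition dist_ell2 :: "ell2 \<Rightarrow> ell2 \<Rightarrow> real" where "dist_ell2 x y = norm (x - y)"
definition uniformity_ell2 :: "(ell2 \<times> ell2) filter"
  where "uniformity_ell2 = (INF e\<in>{0<..}. principal {(x, y). dist x y < e})"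
definition open_ell2 :: "ell2 set \<Rightarrow> bool"
  where "open_ell2 S \<longleftrightarrow> (\<forall>x\<in>S. \<forall>\<^sub>F (x', y) in uniformity. x' = x \<longrightarrow> y \<in> S)"

lemma coord_simps0:
  "coord 0 j = 0" "coord (x + y) j = coord x j + coord y j" "coord (- x) j = - coord x j"
  "coord (c *\<^sub>C x) j = c * coord x j"
  by (transfer; simp)+

lemma cinner_self: "cinner x x = of_real (\<Sum>\<^sub>\<infinity>j. (cmod (coord x j))\<^sup>2)"
proof -
  have *: "cnj a * a = of_real ((cmod a)\<^sup>2)" for a
    by (metis complex_norm_square mult.commute)
  have "((\<lambda>j. (cmod (coord x j))\<^sup>2) has_sum (\<Sum>\<^sub>\<infinity>j. (cmod (coord x j))\<^sup>2)) UNIV"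
    by (intro has_sum_infsum summable_coord)
  then show ?thesis
    unfolding cinner_def * by (intro infsumI has_sum_of_real)
qed

instance
proof
  fix x y z :: ell2 and a b r s :: real
  show "x + y + z = x + (y + z)" "x + y = y + x" "0 + x = x" "- x + x = 0" "x - y = x + - y"
    by (auto intro!: ell2_eqI simp: coord_simps0 minus_ell2_def)
  show "a *\<^sub>R (x + y) = a *\<^sub>R x + a *\<^sub>R y" "(a + b) *\<^sub>R x = a *\<^sub>R x + b *\<^sub>R x"
    "a *\<^sub>R b *\<^sub>R x = (a * b) *\<^sub>R x" "1 *\<^sub>R x = x"
    by (auto intro!: ell2_eqI simp: coord_simps0 scaleR_ell2_def algebra_simps)
  show "sgn x = inverse (norm x) *\<^sub>R x" "dist x y = norm (x - y)"
    "uniformity = (INF e\<in>{0<..}. principal {(x, y::ell2). dist x y < e})"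
    "norm x = sqrt (inner x x)"
    by (auto simp: sgn_ell2_def dist_ell2_def uniformity_ell2_def norm_ell2_def)
  show "open U \<longleftrightarrow> (\<forall>x\<in>U. \<forall>\<^sub>F (x', y) in uniformity. x' = x \<longrightarrow> y \<in> U)" for U :: "ell2 set"
    by (simp add: open_ell2_def)
  have "cinner y x = cnj (cinner x y)"
    unfolding cinner_def by (subst infsum_cnj[symmetric]) (simp add: mult.commute)
  then show "inner x y = inner y x"
    by (simp add: inner_ell2_def)
  have "cinner (x + y) z = cinner x z + cinner y z"
    unfolding cinner_def coord_simps0 complex_cnj_add distrib_right
    by (intro infsum_add summable_coord_mult)
  then show "inner (x + y) z = inner x z + inner y z"
    by (simp add: inner_ell2_def)
  have "cinner (r *\<^sub>R x) y = of_real r * cinner x y"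
    unfolding cinner_def infsum_cmult_right'[symmetric]
    by (simp add: coord_simps0 scaleR_ell2_def mult.assoc)
  then show "inner (r *\<^sub>R x) y = r * inner x y"
    by (simp add: inner_ell2_def)
  show "0 \<le> inner x x"
    by (simp add: inner_ell2_def cinner_self infsum_nonneg)
  show "inner x x = 0 \<longleftrightarrow> x = 0"
  proof
    assume "inner x x = 0"
    then have "(\<Sum>\<^sub>\<infinity>j. (cmod (coord x j))\<^sup>2) = 0"
      by (simp add: inner_ell2_def cinner_self)
    then have "(cmod (coord x j))\<^sup>2 = 0" for j
      using nonneg_infsum_le_0D[where f="\<lambda>j. (cmod (coord x j))\<^sup>2" and A=UNIV, of j]
        summable_coord[of x] by simp
    then show "x = 0"
      by (intro ell2_eqI) (simp add: coord_simps0)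
  qed (simp add: inner_ell2_def cinner_def coord_simps0)
qed

end

lemma coord_simps [simp]:
  "coord 0 j = 0" "coord (x + y) j = coord x j + coord y j" "coord (- x) j = - coord x j"
  "coord (c *\<^sub>C x) j = c * coord x j" "coord (x - y) j = coord x j - coord y j"
  "coord (r *\<^sub>R x) j = of_real r * coord x j"
  by (simp_all only: coord_simps0 minus_ell2_def scaleR_ell2_def)
    (simp_all only: diff_conv_add_uminus)

lemma norm_ell2_square: "(norm x)\<^sup>2 = (\<Sum>\<^sub>\<infinity>j. (cmod (coord x j))\<^sup>2)"
  by (simp add: power2_norm_eq_inner inner_ell2_def cinner_self)

lemma norm_scaleC: "norm (c *\<^sub>C x) = cmod c * norm x"
proof -
  have "(norm (c *\<^sub>C x))\<^sup>2 = (cmod c * norm x)\<^sup>2"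
    by (simp add: norm_ell2_square norm_mult power_mult_distrib infsum_cmult_right')
  then show ?thesis
    by (rule power2_eq_imp_eq) auto
qed

lift_definition basis_vec :: "int \<Rightarrow> ell2" is "\<lambda>k j. if j = k then 1 else 0"
  by (rule finite_nonzero_values_imp_summable_on, rule finite_subset[of _ "{k}" for k]) auto

section \<open>Bounded operators\<close>

text \<open>Elements of \<open>ell2 \<Rightarrow>\<^sub>L ell2\<close> are only real linear; their norm is the operator norm, and the
  bounded operators in the usual sense are those commuting with complex scalars.\<close>

definition bounded_ops :: "(ell2 \<Rightarrow>\<^sub>L ell2) set"
  where "bounded_ops = {T. \<forall>c x. blinfun_apply T (c *\<^sub>C x) = c *\<^sub>C blinfun_apply T x}"

lift_definition scalar_op :: "complex \<Rightarrow> ell2 \<Rightarrow>\<^sub>L ell2" is scaleC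
proof (rule bounded_linear_intro)
  show "c *\<^sub>C (x + y) = c *\<^sub>C x + c *\<^sub>C y" "c *\<^sub>C (r *\<^sub>R x) = r *\<^sub>R (c *\<^sub>C x)" for c x y r
    by (auto intro!: ell2_eqI simp: algebra_simps)
  show "norm (c *\<^sub>C x) \<le> norm x * cmod c" for c x
    by (simp add: norm_scaleC)
qed

abbreviation scale_op :: "complex \<Rightarrow> (ell2 \<Rightarrow>\<^sub>L ell2) \<Rightarrow> (ell2 \<Rightarrow>\<^sub>L ell2)"
  where "scale_op c T \<equiv> scalar_op c o\<^sub>L T"

definition is_adjoint :: "(ell2 \<Rightarrow>\<^sub>L ell2) \<Rightarrow> (ell2 \<Rightarrow>\<^sub>L ell2) \<Rightarrow> bool"
  where "is_adjoint T S \<longleftrightarrow> (\<forall>x y. cinner x (blinfun_apply T y) = cinner (blinfun_apply S x) y)"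

definition matrix_entry :: "(ell2 \<Rightarrow>\<^sub>L ell2) \<Rightarrow> int \<Rightarrow> int \<Rightarrow> complex"
  where "matrix_entry T j k = cinner (basis_vec j) (blinfun_apply T (basis_vec k))"

lift_definition shift_ell2 :: "int \<Rightarrow> ell2 \<Rightarrow> ell2" is "\<lambda>n x j. x (j - n)"
proof -
  fix n and x :: "int \<Rightarrow> complex"
  assume "(\<lambda>j. (cmod (x j))\<^sup>2) summable_on UNIV"
  then show "(\<lambda>j. (cmod (x (j - n)))\<^sup>2) summable_on UNIV"
    using summable_on_reindex_bij_witness[where S=UNIV and T=UNIV and i="\<lambda>j. j + n"
        and j="\<lambda>j. j - n" and h="\<lambda>j. (cmod (x j))\<^sup>2" and g="\<lambda>j. (cmod (x (j - n)))\<^sup>2"]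
    by simp
qed

lemma coord_shift [simp]: "coord (shift_ell2 n x) j = coord x (j - n)"
  by transfer simp

lemma norm_shift [simp]: "norm (shift_ell2 n x) = norm x"
proof -
  have "(norm (shift_ell2 n x))\<^sup>2 = (norm x)\<^sup>2"
    unfolding norm_ell2_square
    by (rule infsum_reindex_bij_witness[where i="\<lambda>j. j + n" and j="\<lambda>j. j - n"]) auto
  then show ?thesis
    by (rule power2_eq_imp_eq) auto
qed

lift_definition shift_op :: "int \<Rightarrow> ell2 \<Rightarrow>\<^sub>L ell2" is shift_ell2
proof (rule bounded_linear_intro)
  show "norm (shift_ell2 n x) \<le> norm x * 1" for n x by simp
qed (auto intro!: ell2_eqI)

definition bilateral_shift :: "ell2 \<Rightarrow>\<^sub>L ell2"
  where "bilateral_shift = shift_op 1"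

lemma bilateral_shift_basis: "blinfun_apply bilateral_shift (basis_vec j) = basis_vec (j + 1)"
  by (rule ell2_eqI) (simp add: bilateral_shift_def shift_op.rep_eq basis_vec.rep_eq)

section \<open>The circle and the identification of its continuous functions with operators\<close>

typedef circle = "sphere (0::complex) 1" morphisms of_circle Abs_circle
  by (rule exI[of _ 1]) simp

instantiation circle :: metric_space
begin

definition dist_circle :: "circle \<Rightarrow> circle \<Rightarrow> real"
  where "dist_circle x y = dist (of_circle x) (of_circle y)"
definition uniformity_circle :: "(circle \<times> circle) filter"
  where "uniformity_circle = (INF e\<in>{0<..}. principal {(x, y). dist x y < e})"
definition open_circle :: "circle set \<Rightarrow> bool"
  where "open_circle S \<longleftrightarrow> (\<forall>x\<in>S. \<forall>\<^sub>F (x', y) in uniformity. x' = x \<longrightarrow> y \<in> S)"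

instance
proof
  fix x y z :: circle
  show "dist x y = 0 \<longleftrightarrow> x = y"
    by (simp add: dist_circle_def of_circle_inject)
  show "dist x y \<le> dist x z + dist y z"
    unfolding dist_circle_def by (rule dist_triangle2)
qed (auto simp: uniformity_circle_def open_circle_def)

end

definition continuous_functions :: "('a::topological_space \<Rightarrow> complex) set"
  where "continuous_functions = {f. continuous_on UNIV f}"

definition laurent_polynomials :: "(circle \<Rightarrow> complex) set"
  where "laurent_polynomials =
    {f. \<exists>N c. finite N \<and> f = (\<lambda>x. \<Sum>n\<in>N. c n * of_circle x powi n)}"

definition cstar_subalgebra :: "(ell2 \<Rightarrow>\<^sub>L ell2) set \<Rightarrow> bool"
  where "cstar_subalgebra A \<longleftrightarrow> A \<subseteq> bounded_ops \<and> closed A \<and> 0 \<in> A \<and>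
    (\<forall>S\<in>A. \<forall>T\<in>A. S + T \<in> A \<and> S o\<^sub>L T \<in> A) \<and> (\<forall>c. \<forall>T\<in>A. scale_op c T \<in> A) \<and>
    (\<forall>T\<in>A. \<exists>S\<in>A. is_adjoint T S)"

definition cstar_generated :: "(ell2 \<Rightarrow>\<^sub>L ell2) \<Rightarrow> (ell2 \<Rightarrow>\<^sub>L ell2) set"
  where "cstar_generated T = \<Inter>{A. cstar_subalgebra A \<and> T \<in> A}"

definition star_isomorphism ::
    "((circle \<Rightarrow> complex) \<Rightarrow> (ell2 \<Rightarrow>\<^sub>L ell2)) \<Rightarrow> (ell2 \<Rightarrow>\<^sub>L ell2) set \<Rightarrow> bool"
  where "star_isomorphism \<Phi> A \<longleftrightarrow> bij_betw \<Phi> continuous_functions A \<and>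
    (\<forall>f\<in>continuous_functions. \<forall>g\<in>continuous_functions.
      \<Phi> (\<lambda>x. f x + g x) = \<Phi> f + \<Phi> g \<and> \<Phi> (\<lambda>x. f x * g x) = \<Phi> f o\<^sub>L \<Phi> g) \<and>
    (\<forall>f\<in>continuous_functions. \<forall>c. \<Phi> (\<lambda>x. c * f x) = scale_op c (\<Phi> f)) \<and>
    (\<forall>f\<in>continuous_functions. is_adjoint (\<Phi> f) (\<Phi> (\<lambda>x. cnj (f x))))"

text \<open>The identification is the \<open>*\<close>-isomorphism of \<open>C(S\<^sup>1)\<close> onto \<open>C\<^sup>*(U)\<close> sending the inclusion
  \<open>of_circle\<close> to the bilateral shift. Existence and uniqueness are \<open>circle_rep_ex1\<close> below;
  extensionality only fixes the value on discontinuous functions.\<close>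

definition circle_rep :: "(circle \<Rightarrow> complex) \<Rightarrow> (ell2 \<Rightarrow>\<^sub>L ell2)"
  where "circle_rep = (THE \<Phi>. \<Phi> \<in> extensional continuous_functions \<and>
    star_isomorphism \<Phi> (cstar_generated bilateral_shift) \<and> \<Phi> of_circle = bilateral_shift)"

section \<open>The \<open>q\<close>-derivative\<close>

definition q_int :: "real \<Rightarrow> int \<Rightarrow> real"
  where "q_int q n = (q powi n - q powi (- n)) / (q - inverse q)"

definition is_q_derivative :: "real \<Rightarrow> (ell2 \<Rightarrow>\<^sub>L ell2) \<Rightarrow> (ell2 \<Rightarrow>\<^sub>L ell2) \<Rightarrow> bool"
  where "is_q_derivative q T S \<longleftrightarrow> S \<in> bounded_ops \<and>
    (\<forall>j k. matrix_entry S j k = \<i> * of_real (q_int q (j - k)) * matrix_entry T j k)"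

definition Lip_q :: "real \<Rightarrow> (ell2 \<Rightarrow>\<^sub>L ell2) set"
  where "Lip_q q = {T \<in> bounded_ops. \<exists>S. is_q_derivative q T S}"

text \<open>Uniqueness of the derivative is \<open>is_q_derivative_unique\<close> below.\<close>

definition q_derivative :: "real \<Rightarrow> (ell2 \<Rightarrow>\<^sub>L ell2) \<Rightarrow> (ell2 \<Rightarrow>\<^sub>L ell2)"
  where "q_derivative q T = (THE S. is_q_derivative q T S)"

definition Lip_q_circle :: "real \<Rightarrow> (ell2 \<Rightarrow>\<^sub>L ell2) set"
  where "Lip_q_circle q = circle_rep ` continuous_functions \<inter> Lip_q q"

definition L_q :: "real \<Rightarrow> (ell2 \<Rightarrow>\<^sub>L ell2) \<Rightarrow> real"
  where "L_q q T = norm (q_derivative q T)"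

definition operator_subsystem :: "(ell2 \<Rightarrow>\<^sub>L ell2) set \<Rightarrow> (ell2 \<Rightarrow>\<^sub>L ell2) set \<Rightarrow> bool"
  where "operator_subsystem X Y \<longleftrightarrow> X \<subseteq> Y \<and> id_blinfun \<in> X \<and>
    (\<forall>S\<in>X. \<forall>T\<in>X. S + T \<in> X) \<and> (\<forall>c. \<forall>T\<in>X. scale_op c T \<in> X) \<and>
    (\<forall>T\<in>X. \<exists>S\<in>X. is_adjoint T S)"

section \<open>Lipschitz functions\<close>

definition compatible_metric :: "('a::topological_space \<Rightarrow> 'a \<Rightarrow> real) \<Rightarrow> bool"
  where "compatible_metric \<rho> \<longleftrightarrow>
    Metric_space UNIV \<rho> \<and> Metric_space.mtopology UNIV \<rho> = euclidean"

definition Lip :: "('a::topological_space \<Rightarrow> 'a \<Rightarrow> real) \<Rightarrow> ('a \<Rightarrow> complex) set"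
  where "Lip \<rho> = {f \<in> continuous_functions. \<exists>C. \<forall>x y. cmod (f x - f y) \<le> C * \<rho> x y}"

definition lipschitz_const :: "('a \<Rightarrow> 'a \<Rightarrow> real) \<Rightarrow> ('a \<Rightarrow> complex) \<Rightarrow> real"
  where "lipschitz_const \<rho> f = Inf {C. 0 \<le> C \<and> (\<forall>x y. cmod (f x - f y) \<le> C * \<rho> x y)}"

definition comes_from_metric ::
    "('a \<Rightarrow> complex) set \<Rightarrow> (('a \<Rightarrow> complex) \<Rightarrow> real) \<Rightarrow> ('a::topological_space \<Rightarrow> 'a \<Rightarrow> real) \<Rightarrow> bool"
  where "comes_from_metric F L \<rho> \<longleftrightarrow> F \<subseteq> Lip \<rho> \<and> (\<forall>f\<in>F. L f = lipschitz_const \<rho> f)"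

section \<open>Well-definedness of the identification and of the derivative\<close>

lemma shift_op_apply [simp]: "blinfun_apply (shift_op n) x = shift_ell2 n x"
  by (simp add: shift_op.rep_eq)

lemma scalar_op_apply [simp]: "blinfun_apply (scalar_op c) x = c *\<^sub>C x"
  by (simp add: scalar_op.rep_eq)

lemma norm_coord_le: "cmod (coord x j) \<le> norm x"
proof (rule power2_le_imp_le)
  have "(\<Sum>i\<in>{j}. (cmod (coord x i))\<^sup>2) \<le> (\<Sum>\<^sub>\<infinity>i. (cmod (coord x i))\<^sup>2)"
    by (intro finite_sum_le_infsum summable_coord) auto
  then show "(cmod (coord x j))\<^sup>2 \<le> (norm x)\<^sup>2"
    by (simp add: norm_ell2_square)
qed simp

lemma coord_basis_vec: "coord (basis_vec k) j = (if j = k then 1 else 0)"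
  by (simp add: basis_vec.rep_eq)

lemma cinner_basis: "cinner (basis_vec j) x = coord x j"
proof -
  have "cinner (basis_vec j) x = (\<Sum>\<^sub>\<infinity>i\<in>{j}. coord x i)"
    unfolding cinner_def by (rule infsum_cong_neutral) (auto simp: coord_basis_vec)
  then show ?thesis by simp
qed

lemma cinner_scaleC_left: "cinner (c *\<^sub>C x) y = cnj c * cinner x y"
  and cinner_scaleC_right: "cinner x (c *\<^sub>C y) = c * cinner x y"
  unfolding cinner_def infsum_cmult_right'[symmetric] by (simp_all add: mult_ac)

lemma cinner_eq: "cinner x y = Complex (inner x y) (inner (\<i> *\<^sub>C x) y)"
  by (simp add: inner_ell2_def cinner_scaleC_left complex_eq_iff)

lemma cinner_commute: "cnj (cinner x y) = cinner y x"
  unfolding cinner_def by (subst infsum_cnj[symmetric]) (simp add: mult.commute)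

lemma scaleC_add_right: "c *\<^sub>C (x + y) = c *\<^sub>C x + c *\<^sub>C y"
  and scaleC_diff_right: "c *\<^sub>C (x - y) = c *\<^sub>C x - c *\<^sub>C y"
  and scaleC_add_left: "(c + d) *\<^sub>C x = c *\<^sub>C x + d *\<^sub>C x"
  and scaleC_scaleC: "c *\<^sub>C d *\<^sub>C x = (c * d) *\<^sub>C x"
  and scaleC_commute: "c *\<^sub>C d *\<^sub>C x = d *\<^sub>C c *\<^sub>C x"
  and scaleC_zero: "0 *\<^sub>C x = 0" "c *\<^sub>C 0 = 0"
  and scaleC_one [simp]: "1 *\<^sub>C x = x"
  by (auto intro!: ell2_eqI simp: algebra_simps)

lemma cinner_add_left: "cinner (x + y) z = cinner x z + cinner y z"
  and cinner_add_right: "cinner z (x + y) = cinner z x + cinner z y"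
  by (simp_all add: cinner_eq inner_add_left inner_add_right scaleC_add_right complex_eq_iff)

lemma cinner_nondegenerate: "(\<And>y. cinner x y = cinner x' y) \<Longrightarrow> x = x'"
  by (metis cinner_basis cinner_commute ell2_eqI)

lemma tendsto_scaleC: "(f \<longlongrightarrow> x) F \<Longrightarrow> ((\<lambda>n. c *\<^sub>C f n) \<longlongrightarrow> c *\<^sub>C x) F"
  using blinfun.tendsto[OF tendsto_const, of f x F "scalar_op c"] by simp

lemma tendsto_cinner:
  "(f \<longlongrightarrow> x) F \<Longrightarrow> (g \<longlongrightarrow> y) F \<Longrightarrow> ((\<lambda>n. cinner (f n) (g n)) \<longlongrightarrow> cinner x y) F"
  unfolding cinner_eq by (intro tendsto_Complex tendsto_inner tendsto_scaleC)

lemma tendsto_coord: "(f \<longlongrightarrow> x) F \<Longrightarrow> ((\<lambda>n. coord (f n) j) \<longlongrightarrow> coord x j) F"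
  using tendsto_cinner[OF tendsto_const, of f x F "basis_vec j"] by (simp add: cinner_basis)

lemma ell2_finite_sums:
  assumes "\<And>F. finite F \<Longrightarrow> (\<Sum>j\<in>F. (cmod (x j))\<^sup>2) \<le> B"
  shows "\<exists>y. coord y = x \<and> (norm y)\<^sup>2 \<le> B"
proof -
  have s: "(\<lambda>j. (cmod (x j))\<^sup>2) summable_on UNIV"
    by (rule nonneg_bdd_above_summable_on) (auto intro!: bdd_aboveI[of _ B] assms)
  then have c: "coord (Abs_ell2 x) = x"
    by (simp add: Abs_ell2_inverse)
  have "(norm (Abs_ell2 x))\<^sup>2 \<le> B"
    unfolding norm_ell2_square c by (rule infsum_le_finite_sums[OF s]) (use assms in auto)
  with c show ?thesis by blast
qed

instance ell2 :: complete_space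
proof
  fix X :: "nat \<Rightarrow> ell2"
  assume X: "Cauchy X"
  have "Cauchy (\<lambda>n. coord (X n) j)" for j
  proof (rule metric_CauchyI)
    fix e :: real assume "e > 0"
    then obtain M where M: "\<And>m n. m \<ge> M \<Longrightarrow> n \<ge> M \<Longrightarrow> norm (X m - X n) < e"
      using X by (metis CauchyD)
    have "dist (coord (X m) j) (coord (X n) j) < e" if "m \<ge> M" "n \<ge> M" for m n
      using M[OF that] norm_coord_le[of "X m - X n" j] by (simp add: dist_norm)
    then show "\<exists>M. \<forall>m\<ge>M. \<forall>n\<ge>M. dist (coord (X m) j) (coord (X n) j) < e" by blast
  qed
  then have "\<forall>j. \<exists>l. (\<lambda>n. coord (X n) j) \<longlonglongrightarrow> l"
    by (simp add: Cauchy_convergent_iff convergent_def)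
  then obtain y where y: "\<And>j. (\<lambda>n. coord (X n) j) \<longlonglongrightarrow> y j"
    by metis
  have *: "\<exists>M. \<forall>m\<ge>M. \<exists>z. coord z = (\<lambda>j. coord (X m) j - y j) \<and> (norm z)\<^sup>2 \<le> e\<^sup>2" if "e > 0" for e
  proof -
    obtain M where M: "\<And>m n. m \<ge> M \<Longrightarrow> n \<ge> M \<Longrightarrow> norm (X m - X n) < e"
      using X \<open>e > 0\<close> by (metis CauchyD)
    have "(\<Sum>j\<in>F. (cmod (coord (X m) j - y j))\<^sup>2) \<le> e\<^sup>2" if "finite F" "m \<ge> M" for F m
    proof (rule tendsto_upperbound)
      show "(\<lambda>n. \<Sum>j\<in>F. (cmod (coord (X m) j - coord (X n) j))\<^sup>2)
          \<longlonglongrightarrow> (\<Sum>j\<in>F. (cmod (coord (X m) j - y j))\<^sup>2)"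
        by (intro tendsto_intros y)
      have "(\<Sum>j\<in>F. (cmod (coord (X m) j - coord (X n) j))\<^sup>2) \<le> e\<^sup>2" if n: "n \<ge> M" for n
      proof -
        have "(\<Sum>j\<in>F. (cmod (coord (X m - X n) j))\<^sup>2) \<le> (norm (X m - X n))\<^sup>2"
          unfolding norm_ell2_square
          by (intro finite_sum_le_infsum summable_coord \<open>finite F\<close>) auto
        also have "\<dots> \<le> e\<^sup>2"
          using M[OF \<open>m \<ge> M\<close> n] by (intro power_mono) auto
        finally show ?thesis by simp
      qed
      then show "\<forall>\<^sub>F n in sequentially. (\<Sum>j\<in>F. (cmod (coord (X m) j - coord (X n) j))\<^sup>2) \<le> e\<^sup>2"
        by (auto simp: eventually_sequentially)
    qed auto
    then show ?thesis
      by (intro exI[of _ M] allI impI ell2_finite_sums) auto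
  qed
  from *[of 1] obtain m z where z: "coord z = (\<lambda>j. coord (X m) j - y j)" by auto
  define Y where "Y = X m - z"
  have Y: "coord Y j = y j" for j by (simp add: Y_def z)
  have "X \<longlonglongrightarrow> Y"
  proof (rule metric_LIMSEQ_I)
    fix e :: real assume "e > 0"
    obtain M where M: "\<And>m. m \<ge> M \<Longrightarrow> \<exists>z. coord z = (\<lambda>j. coord (X m) j - y j) \<and> (norm z)\<^sup>2 \<le> (e/2)\<^sup>2"
      using *[of "e/2"] \<open>e > 0\<close> by auto
    have "dist (X m) Y < e" if m: "m \<ge> M" for m
    proof -
      obtain z where z: "coord z = (\<lambda>j. coord (X m) j - y j)" "(norm z)\<^sup>2 \<le> (e/2)\<^sup>2"
        using M[OF m] by blast
      have "X m - Y = z"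
        by (rule ell2_eqI) (simp add: Y z)
      moreover have "norm z \<le> e/2"
        using z(2) by (rule power2_le_imp_le) (use \<open>e > 0\<close> in simp)
      ultimately show ?thesis using \<open>e > 0\<close> by (simp add: dist_norm)
    qed
    then show "\<exists>M. \<forall>m\<ge>M. dist (X m) Y < e" by blast
  qed
  then show "convergent X" by (auto simp: convergent_def)
qed

instance ell2 :: banach ..

lemma is_adjoint_unique: "is_adjoint T S \<Longrightarrow> is_adjoint T S' \<Longrightarrow> S = S'"
  unfolding is_adjoint_def by (metis blinfun_eqI cinner_nondegenerate)

lemma is_adjoint_add: "is_adjoint T S \<Longrightarrow> is_adjoint T' S' \<Longrightarrow> is_adjoint (T + T') (S + S')"
  by (simp add: is_adjoint_def blinfun.add_left cinner_add_left cinner_add_right)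

lemma is_adjoint_shift: "is_adjoint (shift_op n) (shift_op (- n))"
proof -
  have "cinner x (shift_ell2 n y) = cinner (shift_ell2 (- n) x) y" for x y
    unfolding cinner_def
    by (rule infsum_reindex_bij_witness[where i="\<lambda>j. j + n" and j="\<lambda>j. j - n"]) auto
  then show ?thesis by (simp add: is_adjoint_def)
qed

lemma shift_scaleC [simp]: "shift_ell2 n (c *\<^sub>C x) = c *\<^sub>C shift_ell2 n x"
  and shift_shift [simp]: "shift_ell2 n (shift_ell2 m x) = shift_ell2 (n + m) x"
  and shift_0 [simp]: "shift_ell2 0 x = x"
  and shift_add: "shift_ell2 n (x + y) = shift_ell2 n x + shift_ell2 n y"
  and shift_diff: "shift_ell2 n (x - y) = shift_ell2 n x - shift_ell2 n y"
  by (auto intro!: ell2_eqI simp: algebra_simps)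

lemma norm_of_circle [simp]: "cmod (of_circle x) = 1"
  using of_circle[of x] by simp

lemma of_circle_nonzero [simp]: "of_circle x \<noteq> 0"
  using norm_of_circle[of x] by (metis norm_zero zero_neq_one)

lemma cnj_of_circle: "cnj (of_circle x) = inverse (of_circle x)"
  by (metis complex_div_cnj div_by_1 norm_of_circle inverse_eq_divide mult_1 of_real_1 one_power2)

inductive laurent_pair :: "(circle \<Rightarrow> complex) \<Rightarrow> (ell2 \<Rightarrow>\<^sub>L ell2) \<Rightarrow> bool" where
  mono: "laurent_pair (\<lambda>x. c * of_circle x powi n) (scale_op c (shift_op n))"
| add: "laurent_pair f S \<Longrightarrow> laurent_pair g T \<Longrightarrow> laurent_pair (\<lambda>x. f x + g x) (S + T)"

lemma laurent_pair_bounded_ops: "laurent_pair f T \<Longrightarrow> T \<in> bounded_ops"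
  by (induction rule: laurent_pair.induct)
    (auto simp: bounded_ops_def blinfun.add_left scaleC_add_right scaleC_commute)

lemma laurent_pair_scale: "laurent_pair f T \<Longrightarrow> laurent_pair (\<lambda>x. c * f x) (scale_op c T)"
proof (induction rule: laurent_pair.induct)
  case (mono d n)
  have "scale_op c (scale_op d (shift_op n)) = scale_op (c * d) (shift_op n)"
    by (rule blinfun_eqI) (simp add: scaleC_scaleC)
  with laurent_pair.mono[of "c * d" n] show ?case by (simp add: mult.assoc)
next
  case (add f S g T)
  have "scale_op c (S + T) = scale_op c S + scale_op c T"
    by (rule blinfun_eqI) (simp add: blinfun.add_left blinfun.add_right scaleC_add_right)
  with laurent_pair.add[OF add.IH] show ?case by (simp add: distrib_left)
qed

lemma laurent_pair_mult:
  assumes "laurent_pair f S" "laurent_pair g T"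
  shows "laurent_pair (\<lambda>x. f x * g x) (S o\<^sub>L T)"
  using assms
proof (induction arbitrary: g T rule: laurent_pair.induct)
  case (mono c n)
  from mono show ?case
  proof (induction rule: laurent_pair.induct)
    case (mono d m)
    have "scale_op c (shift_op n) o\<^sub>L scale_op d (shift_op m) = scale_op (c * d) (shift_op (n + m))"
      by (rule blinfun_eqI) (simp add: scaleC_scaleC)
    with laurent_pair.mono[of "c * d" "n + m"] show ?case by (simp add: power_int_add mult_ac)
  next
    case (add f' S' g' T')
    have "scale_op c (shift_op n) o\<^sub>L (S' + T') =
        (scale_op c (shift_op n) o\<^sub>L S') + (scale_op c (shift_op n) o\<^sub>L T')"
      by (rule blinfun_eqI) (simp add: blinfun.add_left shift_add scaleC_add_right)
    with laurent_pair.add[OF add.IH] show ?case by (simp add: distrib_left)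
  qed
next
  case (add f' S' g' T')
  have "(S' + T') o\<^sub>L T = (S' o\<^sub>L T) + (T' o\<^sub>L T)"
    by (rule blinfun_eqI) (simp add: blinfun.add_left)
  with laurent_pair.add[OF add.IH[OF add.prems]] show ?case by (simp add: distrib_right)
qed

lemma laurent_pair_adjoint:
  "laurent_pair f T \<Longrightarrow> \<exists>S. laurent_pair (\<lambda>x. cnj (f x)) S \<and> is_adjoint T S"
proof (induction rule: laurent_pair.induct)
  case (mono c n)
  have "(\<lambda>x. cnj (c * of_circle x powi n)) = (\<lambda>x. cnj c * of_circle x powi (- n))"
    by (simp add: cnj_of_circle power_int_minus power_int_inverse)
  moreover have "is_adjoint (scale_op c (shift_op n)) (scale_op (cnj c) (shift_op (- n)))"
    using is_adjoint_shift[of n]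
    by (simp add: is_adjoint_def cinner_scaleC_left cinner_scaleC_right)
  ultimately show ?case
    using laurent_pair.mono[of "cnj c" "- n"] by auto
next
  case (add f S g T)
  then obtain S' T' where "laurent_pair (\<lambda>x. cnj (f x)) S'" "is_adjoint S S'"
      "laurent_pair (\<lambda>x. cnj (g x)) T'" "is_adjoint T T'"
    by blast
  then have "laurent_pair (\<lambda>x. cnj (f x) + cnj (g x)) (S' + T')" "is_adjoint (S + T) (S' + T')"
    by (auto intro: laurent_pair.add is_adjoint_add)
  then show ?case by auto
qed

lemma norm_laurent_approx_eigen:
  "norm (shift_ell2 n x - of_circle w powi n *\<^sub>C x) \<le>
    \<bar>of_int n\<bar> * norm (shift_ell2 1 x - of_circle w *\<^sub>C x)"
proof (induction n rule: int_induct[where k=0])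
  case base
  then show ?case by simp
next
  case (step1 n)
  have "shift_ell2 (n + 1) x - of_circle w powi (n + 1) *\<^sub>C x =
      shift_ell2 n (shift_ell2 1 x - of_circle w *\<^sub>C x) +
      of_circle w *\<^sub>C (shift_ell2 n x - of_circle w powi n *\<^sub>C x)"
    by (rule ell2_eqI) (simp add: power_int_add algebra_simps)
  also have "norm \<dots> \<le> norm (shift_ell2 1 x - of_circle w *\<^sub>C x) +
      norm (shift_ell2 n x - of_circle w powi n *\<^sub>C x)"
    by (rule order_trans[OF norm_triangle_ineq]) (simp add: norm_scaleC)
  finally show ?case using step1 by (simp add: distrib_right)
next
  case (step2 n)
  have "shift_ell2 (n - 1) x - of_circle w powi (n - 1) *\<^sub>C x =
      inverse (of_circle w) *\<^sub>C (shift_ell2 n x - of_circle w powi n *\<^sub>C x) -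
      inverse (of_circle w) *\<^sub>C shift_ell2 (n - 1) (shift_ell2 1 x - of_circle w *\<^sub>C x)"
    by (rule ell2_eqI) (simp add: power_int_diff field_simps)
  also have "norm \<dots> \<le> norm (shift_ell2 n x - of_circle w powi n *\<^sub>C x) +
      norm (shift_ell2 1 x - of_circle w *\<^sub>C x)"
    by (rule order_trans[OF norm_triangle_ineq4]) (simp add: norm_scaleC norm_inverse)
  finally show ?case using step2 by (simp add: distrib_right algebra_simps)
qed

lift_definition truncated_character :: "circle \<Rightarrow> nat \<Rightarrow> ell2"
  is "\<lambda>w N j. if 0 \<le> j \<and> j < int N then of_circle w powi (- j) else 0"
proof -
  fix w N
  show "(\<lambda>j. (cmod (if 0 \<le> j \<and> j < int N then of_circle w powi (- j) else 0))\<^sup>2) summable_on UNIV"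
    by (rule finite_nonzero_values_imp_summable_on, rule finite_subset[of _ "{0..<int N}"]) auto
qed

lemma norm_truncated_character: "norm (truncated_character w N) = sqrt N"
proof -
  have "(norm (truncated_character w N))\<^sup>2 = (\<Sum>\<^sub>\<infinity>j\<in>{0..<int N}. 1)"
    unfolding norm_ell2_square
    by (rule infsum_cong_neutral)
       (auto simp: truncated_character.rep_eq norm_power_int)
  then have "(norm (truncated_character w N))\<^sup>2 = N" by simp
  then show ?thesis by (metis norm_ge_zero real_sqrt_abs abs_of_nonneg)
qed

lemma truncated_character_eigen:
  "norm (shift_ell2 1 (truncated_character w N) - of_circle w *\<^sub>C truncated_character w N) \<le> 2"
proof (cases "N = 0")
  case True
  then show ?thesis
    using norm_truncated_character[of w 0] by (simp add: norm_eq_zero scaleC_zero shift_diff[of 1 0 0, simplified])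
next
  case False
  have norm1: "norm (basis_vec k) = 1" for k
  proof -
    have "(norm (basis_vec k))\<^sup>2 = (\<Sum>\<^sub>\<infinity>j\<in>{k}. 1)"
      unfolding norm_ell2_square by (rule infsum_cong_neutral) (auto simp: coord_basis_vec)
    then show ?thesis by (simp add: power2_eq_1_iff) (metis norm_ge_zero not_one_le_zero neg_0_le_iff_le)
  qed
  have "shift_ell2 1 (truncated_character w N) - of_circle w *\<^sub>C truncated_character w N =
      of_circle w powi (1 - int N) *\<^sub>C basis_vec (int N) - of_circle w *\<^sub>C basis_vec 0"
    using False
    by (intro ell2_eqI)
      (auto simp: truncated_character.rep_eq coord_basis_vec power_int_diff power_int_minus field_simps)
  also have "norm \<dots> \<le> 2"
    by (rule order_trans[OF norm_triangle_ineq4]) (simp add: norm_scaleC norm1 norm_power_int)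
  finally show ?thesis .
qed

lemma laurent_pair_norm_ge:
  assumes "laurent_pair f T"
  shows "cmod (f w) \<le> norm T"
proof -
  have "\<exists>C. \<forall>N. norm (blinfun_apply T (truncated_character w N) - f w *\<^sub>C truncated_character w N) \<le> C"
    using assms
  proof (induction rule: laurent_pair.induct)
    case (mono c n)
    have "norm (blinfun_apply (scale_op c (shift_op n)) (truncated_character w N) -
        (c * of_circle w powi n) *\<^sub>C truncated_character w N) \<le> cmod c * (\<bar>of_int n\<bar> * 2)" for N
    proof -
      have "norm (shift_ell2 n (truncated_character w N) - of_circle w powi n *\<^sub>C truncated_character w N)
          \<le> \<bar>of_int n\<bar> * 2"
        by (rule order_trans[OF norm_laurent_approx_eigen mult_left_mono[OF truncated_character_eigen]]) simp
      then show ?thesis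
        by (simp add: scaleC_scaleC[symmetric] scaleC_diff_right[symmetric] norm_scaleC mult_left_mono)
    qed
    then show ?case by blast
  next
    case (add f S g T)
    then obtain C D where C: "\<And>N. norm (blinfun_apply S (truncated_character w N) - f w *\<^sub>C truncated_character w N) \<le> C"
      and D: "\<And>N. norm (blinfun_apply T (truncated_character w N) - g w *\<^sub>C truncated_character w N) \<le> D"
      by blast
    have "norm (blinfun_apply (S + T) (truncated_character w N) -
        (f w + g w) *\<^sub>C truncated_character w N) \<le> C + D" for N
      using norm_add_rule_thm[OF C[of N] D[of N]]
      by (simp add: blinfun.add_left scaleC_add_left algebra_simps)
    then show ?case by blast
  qed
  then obtain C where C: "\<And>N. norm (blinfun_apply T (truncated_character w N) - f w *\<^sub>C truncated_character w N) \<le> C"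
    by blast
  have *: "(cmod (f w) - norm T) * sqrt N \<le> C" for N :: nat
  proof -
    have "cmod (f w) * sqrt N = norm (f w *\<^sub>C truncated_character w N)"
      by (simp add: norm_scaleC norm_truncated_character)
    also have "\<dots> \<le> norm (blinfun_apply T (truncated_character w N)) + C"
      using C[of N] norm_triangle_sub[of "f w *\<^sub>C truncated_character w N" "blinfun_apply T (truncated_character w N)"]
      by (simp add: norm_minus_commute)
    also have "\<dots> \<le> norm T * sqrt N + C"
      using norm_blinfun[of T "truncated_character w N"] by (simp add: norm_truncated_character)
    finally show ?thesis by (simp add: algebra_simps)
  qed
  show ?thesis
  proof (rule ccontr)
    assume "\<not> ?thesis"
    then have pos: "cmod (f w) - norm T > 0" by simp
    obtain n :: nat where "(\<bar>C\<bar> + 1) / (cmod (f w) - norm T) < n"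
      using reals_Archimedean2 by blast
    then have "\<bar>C\<bar> + 1 < (cmod (f w) - norm T) * sqrt (real (n\<^sup>2))"
      using pos by (simp add: field_simps)
    with *[of "n\<^sup>2"] show False by linarith
  qed
qed

lemma has_integral_cis:
  "((\<lambda>t. cis (of_int n * t)) has_integral (if n = 0 then 2 * of_real pi else 0)) {0..2 * pi}"
proof (cases "n = 0")
  case True
  then show ?thesis
    using has_integral_const_real[of "1::complex" 0 "2 * pi"] by (simp add: scaleR_conv_of_real)
next
  case False
  have "((\<lambda>t. cis (of_int n * t)) has_integral
      cis (of_int n * (2 * pi)) / (\<i> * of_int n) - cis (of_int n * 0) / (\<i> * of_int n)) {0..2 * pi}"
  proof (rule fundamental_theorem_of_calculus)
    fix t :: real
    have "((\<lambda>z. exp (\<i> * of_int n * z) / (\<i> * of_int n)) has_field_derivative exp (\<i> * of_int n * of_real t)) (at (of_real t))"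
      using False by (auto intro!: derivative_eq_intros)
    then have "((\<lambda>t. exp (\<i> * of_int n * of_real t) / (\<i> * of_int n)) has_vector_derivative exp (\<i> * of_int n * of_real t)) (at t within {0..2*pi})"
      by (rule has_vector_derivative_real_field)
    then show "((\<lambda>t. cis (of_int n * t) / (\<i> * of_int n)) has_vector_derivative cis (of_int n * t)) (at t within {0..2*pi})"
      by (simp add: cis_conv_exp mult_ac)
  qed simp
  moreover have "cis (of_int n * (2 * pi)) = 1"
    using cis_multiple_2pi[of "of_int n"] by (simp add: mult_ac)
  ultimately show ?thesis using False by simp
qed

definition fourier_transform :: "ell2 \<Rightarrow> (real \<Rightarrow> complex) \<Rightarrow> bool"
  where "fourier_transform x F \<longleftrightarrow> (\<exists>S. finite S \<and> (\<forall>j. j \<notin> S \<longrightarrow> coord x j = 0) \<and>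
    F = (\<lambda>t. \<Sum>j\<in>S. coord x j * cis (of_int j * t)))"

lemma fourier_transform_superset:
  assumes "finite S" "finite S'" "S \<subseteq> S'" "\<And>j. j \<notin> S \<Longrightarrow> coord x j = 0"
  shows "(\<Sum>j\<in>S. coord x j * cis (of_int j * t)) = (\<Sum>j\<in>S'. coord x j * cis (of_int j * t))"
  by (rule sum.mono_neutral_left) (use assms in auto)

lemma fourier_transform_add:
  assumes "fourier_transform x F" "fourier_transform y G"
  shows "fourier_transform (x + y) (\<lambda>t. F t + G t)"
proof -
  from assms obtain S S' where S: "finite S" "\<And>j. j \<notin> S \<Longrightarrow> coord x j = 0"
      "F = (\<lambda>t. \<Sum>j\<in>S. coord x j * cis (of_int j * t))"
    and S': "finite S'" "\<And>j. j \<notin> S' \<Longrightarrow> coord y j = 0"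
      "G = (\<lambda>t. \<Sum>j\<in>S'. coord y j * cis (of_int j * t))"
    unfolding fourier_transform_def by blast
  have "(\<lambda>t. F t + G t) = (\<lambda>t. \<Sum>j\<in>S \<union> S'. coord (x + y) j * cis (of_int j * t))"
    unfolding S(3) S'(3)
    using fourier_transform_superset[of S "S \<union> S'" x] fourier_transform_superset[of S' "S \<union> S'" y] S S'
    by (simp add: sum.distrib distrib_right)
  then show ?thesis
    unfolding fourier_transform_def using S S' by (intro exI[of _ "S \<union> S'"]) auto
qed

lemma fourier_transform_scale:
  assumes "fourier_transform x F"
  shows "fourier_transform (c *\<^sub>C x) (\<lambda>t. c * F t)"
  using assms unfolding fourier_transform_def
  by (auto simp: sum_distrib_left mult.assoc)

lemma fourier_transform_shift:
  assumes "fourier_transform x F"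
  shows "fourier_transform (shift_ell2 n x) (\<lambda>t. cis (of_int n * t) * F t)"
proof -
  from assms obtain S where S: "finite S" "\<And>j. j \<notin> S \<Longrightarrow> coord x j = 0"
      "F = (\<lambda>t. \<Sum>j\<in>S. coord x j * cis (of_int j * t))"
    unfolding fourier_transform_def by blast
  have "cis (of_int n * t) * F t = (\<Sum>j\<in>(\<lambda>j. j + n) ` S. coord x (j - n) * cis (of_int j * t))" for t
    unfolding S(3) by (subst sum.reindex) (auto simp: sum_distrib_left cis_mult algebra_simps)
  moreover have "coord x (j - n) = 0" if "j \<notin> (\<lambda>j. j + n) ` S" for j
    using that by (intro S(2)) (metis diff_add_cancel image_eqI)
  ultimately show ?thesis
    unfolding fourier_transform_def using S by (intro exI[of _ "(\<lambda>j. j + n) ` S"]) auto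
qed

lemma of_circle_cis [simp]: "of_circle (Abs_circle (cis t)) = cis t"
  by (simp add: Abs_circle_inverse)

lemma fourier_transform_laurent:
  "laurent_pair f T \<Longrightarrow> fourier_transform x F \<Longrightarrow>
    fourier_transform (blinfun_apply T x) (\<lambda>t. f (Abs_circle (cis t)) * F t)"
proof (induction rule: laurent_pair.induct)
  case (mono c n)
  have "cis t powi n = cis (of_int n * t)" for t
    by (simp add: cis_power_int)
  then show ?case
    using fourier_transform_scale[OF fourier_transform_shift[OF mono], of c n] by (simp add: mult.assoc)
next
  case (add f S g T)
  from fourier_transform_add[OF add.IH(1)[OF add.prems] add.IH(2)[OF add.prems]]
  show ?case by (simp add: blinfun.add_left distrib_right)
qed

lemma parseval:
  assumes "fourier_transform x F"
  shows "((\<lambda>t. (cmod (F t))\<^sup>2) has_integral 2 * pi * (norm x)\<^sup>2) {0..2 * pi}"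
proof -
  from assms obtain S where S: "finite S" "\<And>j. j \<notin> S \<Longrightarrow> coord x j = 0"
      "F = (\<lambda>t. \<Sum>j\<in>S. coord x j * cis (of_int j * t))"
    unfolding fourier_transform_def by blast
  have eq: "complex_of_real ((cmod (F t))\<^sup>2) =
      (\<Sum>j\<in>S. \<Sum>k\<in>S. coord x j * cnj (coord x k) * cis (of_int (j - k) * t))" for t
    unfolding complex_norm_square S(3)
    by (simp add: sum_product cis_cnj cis_mult algebra_simps)
  have "((\<lambda>t. complex_of_real ((cmod (F t))\<^sup>2)) has_integral
      (\<Sum>j\<in>S. \<Sum>k\<in>S. coord x j * cnj (coord x k) * (if j - k = 0 then 2 * of_real pi else 0))) {0..2 * pi}"
    unfolding eq by (intro has_integral_sum has_integral_mult_right has_integral_cis S)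
  also have "(\<Sum>j\<in>S. \<Sum>k\<in>S. coord x j * cnj (coord x k) * (if j - k = 0 then 2 * of_real pi else 0)) =
      (\<Sum>j\<in>S. of_real (2 * pi * (cmod (coord x j))\<^sup>2))"
  proof (intro sum.cong refl)
    fix j assume j: "j \<in> S"
    have "(\<Sum>k\<in>S. coord x j * cnj (coord x k) * (if j - k = 0 then 2 * of_real pi else 0)) =
        (\<Sum>k\<in>S. if k = j then coord x j * cnj (coord x j) * (2 * of_real pi) else 0)"
      by (intro sum.cong) auto
    also have "\<dots> = coord x j * cnj (coord x j) * (2 * of_real pi)"
      using S(1) j by simp
    also have "\<dots> = of_real (2 * pi * (cmod (coord x j))\<^sup>2)"
      unfolding complex_norm_square[symmetric] by simp
    finally show "(\<Sum>k\<in>S. coord x j * cnj (coord x k) * (if j - k = 0 then 2 * of_real pi else 0)) =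
        of_real (2 * pi * (cmod (coord x j))\<^sup>2)" .
  qed
  finally have "((\<lambda>t. complex_of_real ((cmod (F t))\<^sup>2)) has_integral
      (\<Sum>j\<in>S. of_real (2 * pi * (cmod (coord x j))\<^sup>2))) {0..2 * pi}" .
  from has_integral_linear[OF this bounded_linear_Re]
  have "((\<lambda>t. (cmod (F t))\<^sup>2) has_integral (\<Sum>j\<in>S. 2 * pi * (cmod (coord x j))\<^sup>2)) {0..2 * pi}"
    by (simp only: o_def Re_sum Re_complex_of_real)
  moreover have "(norm x)\<^sup>2 = (\<Sum>j\<in>S. (cmod (coord x j))\<^sup>2)"
  proof -
    have "(norm x)\<^sup>2 = (\<Sum>\<^sub>\<infinity>j\<in>S. (cmod (coord x j))\<^sup>2)"
      unfolding norm_ell2_square by (rule infsum_cong_neutral) (auto simp: S)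
    with S(1) show ?thesis by simp
  qed
  ultimately show ?thesis
    by (simp add: sum_distrib_left)
qed

lemma finite_support_dense:
  assumes "e > 0"
  shows "\<exists>y F. fourier_transform y F \<and> norm (x - y) \<le> e"
proof -
  have hs: "((\<lambda>j. (cmod (coord x j))\<^sup>2) has_sum (norm x)\<^sup>2) UNIV"
    unfolding norm_ell2_square by (intro has_sum_infsum summable_coord)
  obtain S where S: "finite S" "\<bar>(\<Sum>j\<in>S. (cmod (coord x j))\<^sup>2) - (norm x)\<^sup>2\<bar> \<le> e\<^sup>2"
    using has_sum_finite_approximation[OF hs, of "e\<^sup>2"] assms by (auto simp: dist_real_def)
  have "\<exists>y. coord y = (\<lambda>j. if j \<in> S then coord x j else 0) \<and> (norm y)\<^sup>2 \<le> (norm x)\<^sup>2"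
  proof (rule ell2_finite_sums)
    fix G :: "int set" assume G: "finite G"
    have "(\<Sum>j\<in>G. (cmod (if j \<in> S then coord x j else 0))\<^sup>2) \<le> (\<Sum>j\<in>G. (cmod (coord x j))\<^sup>2)"
      by (rule sum_mono) auto
    also have "\<dots> \<le> (norm x)\<^sup>2"
      unfolding norm_ell2_square by (intro finite_sum_le_infsum summable_coord G) auto
    finally show "(\<Sum>j\<in>G. (cmod (if j \<in> S then coord x j else 0))\<^sup>2) \<le> (norm x)\<^sup>2" .
  qed
  then obtain y where y: "coord y = (\<lambda>j. if j \<in> S then coord x j else 0)" by blast
  have "((\<lambda>j. (cmod (coord x j))\<^sup>2) has_sum ((norm x)\<^sup>2 - (\<Sum>j\<in>S. (cmod (coord x j))\<^sup>2))) (UNIV - S)"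
    by (rule has_sum_Diff[OF hs]) (auto simp: S)
  then have "(\<Sum>\<^sub>\<infinity>j\<in>UNIV - S. (cmod (coord x j))\<^sup>2) = (norm x)\<^sup>2 - (\<Sum>j\<in>S. (cmod (coord x j))\<^sup>2)"
    by (rule infsumI)
  moreover have "(norm (x - y))\<^sup>2 = (\<Sum>\<^sub>\<infinity>j\<in>UNIV - S. (cmod (coord x j))\<^sup>2)"
    unfolding norm_ell2_square by (rule infsum_cong_neutral) (auto simp: y)
  ultimately have "(norm (x - y))\<^sup>2 \<le> e\<^sup>2" using S by simp
  then have "norm (x - y) \<le> e" by (rule power2_le_imp_le) (use assms in simp)
  moreover have "fourier_transform y (\<lambda>t. \<Sum>j\<in>S. coord y j * cis (of_int j * t))"
    unfolding fourier_transform_def by (rule exI[of _ S]) (simp add: S y)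
  ultimately show ?thesis by blast
qed

lemma laurent_pair_norm_le:
  assumes T: "laurent_pair f T" and M: "\<And>z. cmod (f z) \<le> M"
  shows "norm T \<le> M"
proof -
  have M0: "M \<ge> 0" using M[of undefined] norm_ge_zero order_trans by blast
  have *: "norm (blinfun_apply T y) \<le> M * norm y" if "fourier_transform y F" for y F
  proof -
    have "2 * pi * (norm (blinfun_apply T y))\<^sup>2 \<le> M\<^sup>2 * (2 * pi * (norm y)\<^sup>2)"
    proof (rule has_integral_le)
      show "((\<lambda>t. (cmod (f (Abs_circle (cis t)) * F t))\<^sup>2) has_integral
          2 * pi * (norm (blinfun_apply T y))\<^sup>2) {0..2 * pi}"
        by (rule parseval[OF fourier_transform_laurent[OF T that]])
      show "((\<lambda>t. M\<^sup>2 * (cmod (F t))\<^sup>2) has_integral M\<^sup>2 * (2 * pi * (norm y)\<^sup>2)) {0..2 * pi}"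
        by (intro has_integral_mult_right parseval that)
      show "(cmod (f (Abs_circle (cis t)) * F t))\<^sup>2 \<le> M\<^sup>2 * (cmod (F t))\<^sup>2" for t
        unfolding norm_mult power_mult_distrib by (intro mult_right_mono power_mono M) auto
    qed
    then have "(norm (blinfun_apply T y))\<^sup>2 \<le> (M * norm y)\<^sup>2"
      by (simp add: power_mult_distrib field_simps)
    then show ?thesis by (rule power2_le_imp_le) (use M0 in simp)
  qed
  show ?thesis
  proof (rule norm_blinfun_bound[OF M0])
    fix x
    show "norm (blinfun_apply T x) \<le> M * norm x"
    proof (rule field_le_epsilon)
      fix e :: real assume "e > 0"
      define d where "d = e / (norm T + M + 1)"
      have nz: "norm T + M + 1 > 0" using M0 norm_ge_zero[of T] by linarith
      have d: "d > 0" using \<open>e > 0\<close> nz by (simp add: d_def)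
      obtain y F where y: "fourier_transform y F" "norm (x - y) \<le> d"
        using finite_support_dense[OF d] by blast
      have "norm (blinfun_apply T x) \<le> norm (blinfun_apply T y) + norm (blinfun_apply T (x - y))"
        using norm_triangle_ineq[of "blinfun_apply T y" "blinfun_apply T (x - y)"]
        by (simp add: blinfun.diff_right)
      also have "norm (blinfun_apply T (x - y)) \<le> norm T * d"
        by (rule order_trans[OF norm_blinfun mult_left_mono[OF y(2)]]) simp
      also have "norm (blinfun_apply T y) \<le> M * (norm x + d)"
      proof (rule order_trans[OF *[OF y(1)] mult_left_mono[OF _ M0]])
        show "norm y \<le> norm x + d"
          using y(2) norm_triangle_sub[of y x] by (simp add: norm_minus_commute)
      qed
      finally have "norm (blinfun_apply T x) \<le> M * norm x + (norm T + M) * d"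
        by (simp add: algebra_simps)
      also have "(norm T + M) * d \<le> e"
        using \<open>e > 0\<close> nz by (simp add: d_def field_simps)
      finally show "norm (blinfun_apply T x) \<le> M * norm x + e" by simp
    qed
  qed
qed

lemma continuous_on_of_circle: "continuous_on UNIV of_circle"
  by (rule continuous_on_iff[THEN iffD2]) (auto simp: dist_circle_def)

lemma compact_circle: "compact (UNIV :: circle set)"
proof -
  have "continuous_on (sphere 0 1) Abs_circle"
    by (rule continuous_on_iff[THEN iffD2]) (auto simp: dist_circle_def Abs_circle_inverse)
  then have "compact (Abs_circle ` sphere 0 1)"
    by (rule compact_continuous_image) simp
  moreover have "Abs_circle ` sphere 0 1 = UNIV"
    using type_definition.Abs_image[OF type_definition_circle] .
  ultimately show ?thesis by simp
qed

lemma laurent_pair_continuous: "laurent_pair f T \<Longrightarrow> continuous_on UNIV f"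
  by (induction rule: laurent_pair.induct)
    (auto intro!: continuous_intros continuous_on_of_circle)

lemma laurent_pair_const: "laurent_pair (\<lambda>_. c) (scalar_op c)"
proof -
  have "scale_op c (shift_op 0) = scalar_op c"
    by (rule blinfun_eqI) simp
  then show ?thesis using laurent_pair.mono[of c 0] by simp
qed

lemma laurent_dense_real:
  fixes f :: "circle \<Rightarrow> real"
  assumes f: "continuous_on UNIV f" and e: "e > 0"
  shows "\<exists>g T. laurent_pair (\<lambda>x. of_real (g x)) T \<and> (\<forall>x. \<bar>f x - g x\<bar> < e)"
proof -
  let ?P = "\<lambda>g :: circle \<Rightarrow> real. \<exists>T. laurent_pair (\<lambda>x. of_real (g x)) T"
  have Re: "?P (\<lambda>x. Re (of_circle x))" and Im: "?P (\<lambda>x. Im (of_circle x))"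
  proof -
    have z: "inverse (of_circle x) = cnj (of_circle x)" for x
      by (simp add: cnj_of_circle)
    have "(\<lambda>x. complex_of_real (Re (of_circle x))) =
        (\<lambda>x. 1/2 * of_circle x powi 1 + 1/2 * of_circle x powi (-1))"
      by (simp add: fun_eq_iff complex_eq_iff z)
    then show "?P (\<lambda>x. Re (of_circle x))"
      using laurent_pair.add[OF laurent_pair.mono[of "1/2" 1] laurent_pair.mono[of "1/2" "-1"]]
      by auto
    have "(\<lambda>x. complex_of_real (Im (of_circle x))) =
        (\<lambda>x. - \<i>/2 * of_circle x powi 1 + \<i>/2 * of_circle x powi (-1))"
      by (simp add: fun_eq_iff complex_eq_iff z)
    then show "?P (\<lambda>x. Im (of_circle x))"
      using laurent_pair.add[OF laurent_pair.mono[of "- \<i>/2" 1] laurent_pair.mono[of "\<i>/2" "-1"]]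
      by auto
  qed
  have "\<exists>g. ?P g \<and> (\<forall>x\<in>UNIV. \<bar>f x - g x\<bar> < e)"
  proof (rule Stone_Weierstrass_HOL[OF compact_circle])
    show "?P (\<lambda>x. c)" for c
      using laurent_pair_const by blast
    show "continuous_on UNIV g" if g: "?P g" for g
    proof -
      from g obtain T where "laurent_pair (\<lambda>x. of_real (g x)) T" by blast
      then have "continuous_on UNIV (\<lambda>x. Re (of_real (g x)))"
        by (intro continuous_on_Re laurent_pair_continuous)
      then show ?thesis by simp
    qed
    show "?P (\<lambda>x. g x + h x)" "?P (\<lambda>x. g x * h x)" if "?P g \<and> ?P h" for g h
      using that laurent_pair.add laurent_pair_mult by fastforce+
    show "\<exists>f. ?P f \<and> f x \<noteq> f y" if "x \<in> UNIV \<and> y \<in> UNIV \<and> x \<noteq> y" for x y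
    proof -
      have "of_circle x \<noteq> of_circle y" using that by (simp add: of_circle_inject)
      then have "Re (of_circle x) \<noteq> Re (of_circle y) \<or> Im (of_circle x) \<noteq> Im (of_circle y)"
        by (simp add: complex_eq_iff)
      then show ?thesis
        using Re Im exI[of "\<lambda>g. ?P g \<and> g x \<noteq> g y" "\<lambda>x. Re (of_circle x)"]
          exI[of "\<lambda>g. ?P g \<and> g x \<noteq> g y" "\<lambda>x. Im (of_circle x)"] by argo
    qed
  qed (use f e in auto)
  then show ?thesis by auto
qed

lemma laurent_dense:
  assumes f: "continuous_on UNIV f" and e: "e > 0"
  shows "\<exists>g T. laurent_pair g T \<and> (\<forall>x. cmod (f x - g x) < e)"
proof -
  obtain g1 T1 where 1: "laurent_pair (\<lambda>x. of_real (g1 x)) T1" "\<And>x. \<bar>Re (f x) - g1 x\<bar> < e/2"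
    using laurent_dense_real[of "\<lambda>x. Re (f x)" "e/2"] continuous_on_Re[OF f] e by auto
  obtain g2 T2 where 2: "laurent_pair (\<lambda>x. of_real (g2 x)) T2" "\<And>x. \<bar>Im (f x) - g2 x\<bar> < e/2"
    using laurent_dense_real[of "\<lambda>x. Im (f x)" "e/2"] continuous_on_Im[OF f] e by auto
  have "cmod (f x - (of_real (g1 x) + \<i> * of_real (g2 x))) < e" for x
    using cmod_le[of "f x - (of_real (g1 x) + \<i> * of_real (g2 x))"] 1(2)[of x] 2(2)[of x] by simp
  with laurent_pair.add[OF 1(1) laurent_pair_scale[OF 2(1), of \<i>]] show ?thesis by blast
qed

definition laurent_limit :: "(circle \<Rightarrow> complex) \<Rightarrow> (ell2 \<Rightarrow>\<^sub>L ell2) \<Rightarrow> bool"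
  where "laurent_limit f T \<longleftrightarrow> (\<exists>G S. (\<forall>n. laurent_pair (G n) (S n)) \<and>
    uniform_limit UNIV G f sequentially \<and> S \<longlonglongrightarrow> T)"

lemma laurent_limit_continuous: "laurent_limit f T \<Longrightarrow> f \<in> continuous_functions"
  unfolding laurent_limit_def continuous_functions_def mem_Collect_eq
proof (elim exE conjE)
  fix G S assume G: "\<forall>n. laurent_pair (G n) (S n)" "uniform_limit UNIV G f sequentially"
  have "continuous_on UNIV (G n)" for n
    using G(1) by (blast intro: laurent_pair_continuous)
  with G(2) show "continuous_on UNIV f"
    by (intro uniform_limit_theorem[where f=G and F=sequentially and A=UNIV]) auto
qed

lemma laurent_pair_limit: "laurent_pair f T \<Longrightarrow> laurent_limit f T"
  unfolding laurent_limit_def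
  by (intro exI[of _ "\<lambda>_. f"] exI[of _ "\<lambda>_. T"]) (auto simp: uniform_limit_const)

lemma continuous_bounded:
  "f \<in> continuous_functions \<Longrightarrow> bounded (range (f :: circle \<Rightarrow> complex))"
  unfolding continuous_functions_def
  using compact_continuous_image[OF _ compact_circle] compact_imp_bounded by auto

lemma laurent_limit_add:
  assumes "laurent_limit f S" "laurent_limit g T"
  shows "laurent_limit (\<lambda>x. f x + g x) (S + T)"
proof -
  from assms obtain F A G B where
    "\<And>n. laurent_pair (F n) (A n)" "uniform_limit UNIV F f sequentially" "A \<longlonglongrightarrow> S"
    "\<And>n. laurent_pair (G n) (B n)" "uniform_limit UNIV G g sequentially" "B \<longlonglongrightarrow> T"
    unfolding laurent_limit_def by blast
  then show ?thesis
    unfolding laurent_limit_def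
    by (intro exI[of _ "\<lambda>n x. F n x + G n x"] exI[of _ "\<lambda>n. A n + B n"])
      (auto intro: laurent_pair.add uniform_limit_add tendsto_add)
qed

lemma laurent_limit_mult:
  assumes "laurent_limit f S" "laurent_limit g T"
  shows "laurent_limit (\<lambda>x. f x * g x) (S o\<^sub>L T)"
proof -
  from assms obtain F A G B where
    "\<And>n. laurent_pair (F n) (A n)" "uniform_limit UNIV F f sequentially" "A \<longlonglongrightarrow> S"
    "\<And>n. laurent_pair (G n) (B n)" "uniform_limit UNIV G g sequentially" "B \<longlonglongrightarrow> T"
    unfolding laurent_limit_def by blast
  then show ?thesis
    unfolding laurent_limit_def
    using continuous_bounded laurent_limit_continuous assms
    by (intro exI[of _ "\<lambda>n x. F n x * G n x"] exI[of _ "\<lambda>n. A n o\<^sub>L B n"])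
      (auto intro: laurent_pair_mult uniform_lim_mult
        bounded_bilinear.tendsto[OF bounded_bilinear_blinfun_compose])
qed

lemma laurent_limit_scale:
  assumes "laurent_limit f T"
  shows "laurent_limit (\<lambda>x. c * f x) (scale_op c T)"
  using laurent_limit_mult[OF laurent_pair_limit[OF laurent_pair_const] assms] .

lemma laurent_limit_bounds:
  assumes "laurent_limit f T"
  shows "cmod (f x) \<le> norm T" and "(\<And>z. cmod (f z) \<le> M) \<Longrightarrow> norm T \<le> M"
proof -
  from assms obtain G S where G: "\<And>n. laurent_pair (G n) (S n)"
    "uniform_limit UNIV G f sequentially" "S \<longlonglongrightarrow> T"
    unfolding laurent_limit_def by blast
  have "(\<lambda>n. G n x) \<longlonglongrightarrow> f x"
    using G(2) by (rule tendsto_uniform_limitI) simp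
  then show "cmod (f x) \<le> norm T"
    using G(3) laurent_pair_norm_ge[OF G(1)]
    by (intro tendsto_le[OF _ tendsto_norm tendsto_norm]) auto
  show "norm T \<le> M" if M: "\<And>z. cmod (f z) \<le> M"
  proof (rule field_le_epsilon)
    fix e :: real assume e: "e > 0"
    have "\<forall>\<^sub>F n in sequentially. norm (S n) \<le> M + e"
      using uniform_limitD[OF G(2) e]
    proof eventually_elim
      case (elim n)
      have "cmod (G n z) \<le> M + e" for z
        using bspec[OF elim, of z] M[of z] norm_triangle_sub[of "G n z" "f z"]
        by (simp add: dist_norm)
      then show ?case by (rule laurent_pair_norm_le[OF G(1)])
    qed
    then show "norm T \<le> M + e"
      using tendsto_norm[OF G(3)] by (intro tendsto_upperbound) auto
  qed
qed

lemma laurent_limit_minus: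
  assumes "laurent_limit f S" "laurent_limit g T"
  shows "laurent_limit (\<lambda>x. f x - g x) (S - T)"
proof -
  have "scale_op (- 1) T = - T"
    by (rule blinfun_eqI) (auto intro!: ell2_eqI simp: blinfun.minus_left)
  then show ?thesis
    using laurent_limit_add[OF assms(1) laurent_limit_scale[OF assms(2), of "- 1"]] by simp
qed

lemma laurent_limit_unique_op: "laurent_limit f S \<Longrightarrow> laurent_limit f T \<Longrightarrow> S = T"
  using laurent_limit_bounds(2)[OF laurent_limit_minus[of f S f T], of 0] by simp

lemma laurent_limit_unique_fun: "laurent_limit f T \<Longrightarrow> laurent_limit g T \<Longrightarrow> f = g"
  using laurent_limit_bounds(1)[OF laurent_limit_minus[of f T g T]] by (auto simp: fun_eq_iff)

lemma laurent_limit_exists: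
  assumes "f \<in> continuous_functions"
  shows "\<exists>T. laurent_limit f T"
proof -
  have "\<exists>g T. laurent_pair g T \<and> (\<forall>x. cmod (f x - g x) < 1 / Suc n)" for n
    using laurent_dense[of f "1 / Suc n"] assms by (simp add: continuous_functions_def)
  then obtain G S where G: "\<And>n. laurent_pair (G n) (S n)" "\<And>n x. cmod (f x - G n x) < 1 / Suc n"
    by metis
  have lim: "uniform_limit UNIV G f sequentially"
  proof (rule uniform_limitI)
    fix e :: real assume "e > 0"
    then have "\<forall>\<^sub>F n in sequentially. 1 / Suc n < e"
      using order_tendstoD(2)[OF LIMSEQ_inverse_real_of_nat, of e] by (simp add: inverse_eq_divide)
    then show "\<forall>\<^sub>F n in sequentially. \<forall>x\<in>UNIV. dist (G n x) (f x) < e"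
    proof eventually_elim
      case (elim n)
      have "dist (G n x) (f x) < e" for x
        using elim G(2)[where n=n and x=x] by (simp add: dist_norm norm_minus_commute)
      then show ?case by blast
    qed
  qed
  have "Cauchy S"
  proof (rule metric_CauchyI)
    fix e :: real assume e: "e > 0"
    obtain N where N: "\<And>n x. n \<ge> N \<Longrightarrow> dist (G n x) (f x) < e/3"
      using uniform_limitD[OF lim, of "e/3"] e by (auto simp: eventually_sequentially)
    have "dist (S m) (S n) < e" if "m \<ge> N" "n \<ge> N" for m n
    proof -
      have "cmod (G m x - G n x) \<le> 2 * e / 3" for x
        using N[OF that(1), of x] N[OF that(2), of x] dist_triangle2[of "G m x" "G n x" "f x"]
        by (simp add: dist_norm)
      then have "norm (S m - S n) \<le> 2 * e / 3"
        by (rule laurent_limit_bounds(2)[OF laurent_limit_minus[OF laurent_pair_limit[OF G(1)] laurent_pair_limit[OF G(1)]]])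
      with e show ?thesis by (simp add: dist_norm)
    qed
    then show "\<exists>N. \<forall>m\<ge>N. \<forall>n\<ge>N. dist (S m) (S n) < e" by blast
  qed
  then obtain T where "S \<longlonglongrightarrow> T" by (auto simp: Cauchy_convergent_iff convergent_def)
  with lim G(1) show ?thesis unfolding laurent_limit_def by blast
qed

lemma laurent_limit_closed:
  assumes L: "\<And>n. laurent_limit (f n) (T n)" and T: "T \<longlonglongrightarrow> A"
  shows "\<exists>g. laurent_limit g A"
proof -
  have "\<exists>G S. laurent_pair G S \<and> norm (S - T n) < 1 / Suc n" for n
  proof -
    from L[of n] obtain F B where F: "\<And>k. laurent_pair (F k) (B k)" "B \<longlonglongrightarrow> T n"
      unfolding laurent_limit_def by blast
    from LIMSEQ_D[OF F(2), of "1 / Suc n"] obtain k where "norm (B k - T n) < 1 / Suc n"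
      by auto
    with F(1) show ?thesis by blast
  qed
  then obtain G S where G: "\<And>n. laurent_pair (G n) (S n)" "\<And>n. norm (S n - T n) < 1 / Suc n"
    by metis
  have "(\<lambda>n. S n - T n) \<longlonglongrightarrow> 0"
    by (rule LIMSEQ_norm_0) (use G(2) in auto)
  from tendsto_add[OF this T] have S: "S \<longlonglongrightarrow> A" by simp
  have "uniformly_Cauchy_on UNIV G"
  proof (rule uniformly_Cauchy_onI)
    fix e :: real assume "e > 0"
    then obtain M where M: "\<And>m n. m \<ge> M \<Longrightarrow> n \<ge> M \<Longrightarrow> norm (S m - S n) < e"
      using CauchyD[OF LIMSEQ_imp_Cauchy[OF S]] by blast
    have "dist (G m x) (G n x) < e" if "m \<ge> M" "n \<ge> M" for m n x
      using M[OF that] laurent_limit_bounds(1)[OF laurent_limit_minus[OF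
          laurent_pair_limit[OF G(1)[of m]] laurent_pair_limit[OF G(1)[of n]]], of x]
      by (simp add: dist_norm)
    then show "\<exists>M. \<forall>x\<in>UNIV. \<forall>m\<ge>M. \<forall>n\<ge>M. dist (G m x) (G n x) < e" by blast
  qed
  then obtain g where "uniform_limit UNIV G g sequentially"
    using Cauchy_uniformly_convergent uniformly_convergent_on_def by blast
  with G(1) S show ?thesis unfolding laurent_limit_def by blast
qed

lemma is_adjoint_lim:
  assumes "\<And>n. is_adjoint (T n) (S n)" "T \<longlonglongrightarrow> A" "S \<longlonglongrightarrow> B"
  shows "is_adjoint A B"
  unfolding is_adjoint_def
proof (intro allI)
  fix x y
  have "(\<lambda>n. cinner x (blinfun_apply (T n) y)) \<longlonglongrightarrow> cinner x (blinfun_apply A y)"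
    by (intro tendsto_cinner tendsto_const blinfun.tendsto assms)
  moreover have "(\<lambda>n. cinner (blinfun_apply (S n) x) y) \<longlonglongrightarrow> cinner (blinfun_apply B x) y"
    by (intro tendsto_cinner tendsto_const blinfun.tendsto assms)
  ultimately show "cinner x (blinfun_apply A y) = cinner (blinfun_apply B x) y"
    using assms(1) by (simp add: is_adjoint_def LIMSEQ_unique)
qed

lemma laurent_limit_adjoint:
  assumes "laurent_limit f T" "laurent_limit (\<lambda>x. cnj (f x)) T'"
  shows "is_adjoint T T'"
proof -
  from assms obtain G S where G: "\<And>n. laurent_pair (G n) (S n)"
    "uniform_limit UNIV G f sequentially" "S \<longlonglongrightarrow> T"
    unfolding laurent_limit_def by blast
  have "\<exists>S'. laurent_pair (\<lambda>x. cnj (G n x)) S' \<and> is_adjoint (S n) S'" for n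
    by (rule laurent_pair_adjoint[OF G(1)])
  then obtain S' where S': "\<And>n. laurent_pair (\<lambda>x. cnj (G n x)) (S' n)" "\<And>n. is_adjoint (S n) (S' n)"
    by metis
  have "S' \<longlonglongrightarrow> T'"
  proof (rule LIMSEQ_I)
    fix e :: real assume e: "e > 0"
    obtain N where N: "\<And>n x. n \<ge> N \<Longrightarrow> dist (G n x) (f x) < e/2"
      using uniform_limitD[OF G(2), of "e/2"] e by (auto simp: eventually_sequentially)
    have "norm (S' n - T') < e" if n: "n \<ge> N" for n
    proof -
      have "cmod (cnj (G n x) - cnj (f x)) \<le> e/2" for x
        using N[OF n, of x] by (simp add: dist_norm flip: complex_cnj_diff)
      then have "norm (S' n - T') \<le> e/2"
        by (rule laurent_limit_bounds(2)[OF laurent_limit_minus[OF laurent_pair_limit[OF S'(1)] assms(2)]])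
      with e show ?thesis by simp
    qed
    then show "\<exists>N. \<forall>n\<ge>N. norm (S' n - T') < e" by blast
  qed
  with S'(2) G(3) show ?thesis by (rule is_adjoint_lim)
qed

lemma continuous_functions_cnj:
  "f \<in> continuous_functions \<Longrightarrow> (\<lambda>x. cnj (f x)) \<in> continuous_functions"
  by (auto simp: continuous_functions_def intro: continuous_on_cnj)

lemma laurent_limit_bounded_ops: "laurent_limit f T \<Longrightarrow> T \<in> bounded_ops"
proof -
  assume "laurent_limit f T"
  then obtain G S where G: "\<And>n. laurent_pair (G n) (S n)" "S \<longlonglongrightarrow> T"
    unfolding laurent_limit_def by blast
  have "blinfun_apply T (c *\<^sub>C x) = c *\<^sub>C blinfun_apply T x" for c x
  proof (rule LIMSEQ_unique)
    show "(\<lambda>n. blinfun_apply (S n) (c *\<^sub>C x)) \<longlonglongrightarrow> blinfun_apply T (c *\<^sub>C x)"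
      by (intro blinfun.tendsto G tendsto_const)
    have "(\<lambda>n. c *\<^sub>C blinfun_apply (S n) x) \<longlonglongrightarrow> c *\<^sub>C blinfun_apply T x"
      by (intro tendsto_scaleC blinfun.tendsto G tendsto_const)
    then show "(\<lambda>n. blinfun_apply (S n) (c *\<^sub>C x)) \<longlonglongrightarrow> c *\<^sub>C blinfun_apply T x"
      using laurent_pair_bounded_ops[OF G(1)] by (simp add: bounded_ops_def)
  qed
  then show ?thesis by (simp add: bounded_ops_def)
qed

lemma laurent_limit_cstar: "cstar_subalgebra {T. \<exists>f. laurent_limit f T}"
  unfolding cstar_subalgebra_def
proof (intro conjI ballI allI)
  show "{T. \<exists>f. laurent_limit f T} \<subseteq> bounded_ops"
    using laurent_limit_bounded_ops by blast
  show "closed {T. \<exists>f. laurent_limit f T}"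
    unfolding closed_sequential_limits
  proof (intro allI impI)
    fix x l assume "(\<forall>n. x n \<in> {T. \<exists>f. laurent_limit f T}) \<and> x \<longlonglongrightarrow> l"
    then have x: "\<forall>n. \<exists>f. laurent_limit f (x n)" "x \<longlonglongrightarrow> l" by auto
    from x(1) obtain f where "\<And>n. laurent_limit (f n) (x n)" by metis
    from laurent_limit_closed[OF this x(2)] show "l \<in> {T. \<exists>f. laurent_limit f T}" by simp
  qed
  have "scalar_op 0 = 0"
    by (rule blinfun_eqI) (simp add: scaleC_zero)
  then show "0 \<in> {T. \<exists>f. laurent_limit f T}"
    using laurent_pair_limit[OF laurent_pair_const[of 0]] by auto
  show "S + T \<in> {T. \<exists>f. laurent_limit f T}" "S o\<^sub>L T \<in> {T. \<exists>f. laurent_limit f T}"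
    if "S \<in> {T. \<exists>f. laurent_limit f T}" "T \<in> {T. \<exists>f. laurent_limit f T}" for S T
    using that by (auto intro: laurent_limit_add laurent_limit_mult)
  show "scale_op c T \<in> {T. \<exists>f. laurent_limit f T}"
    "\<exists>S\<in>{T. \<exists>f. laurent_limit f T}. is_adjoint T S"
    if T: "T \<in> {T. \<exists>f. laurent_limit f T}" for c T
  proof -
    from T obtain f where f: "laurent_limit f T" by auto
    then show "scale_op c T \<in> {T. \<exists>f. laurent_limit f T}"
      by (auto intro: laurent_limit_scale)
    obtain T' where "laurent_limit (\<lambda>x. cnj (f x)) T'"
      using laurent_limit_exists[OF continuous_functions_cnj[OF laurent_limit_continuous[OF f]]] by blast
    with laurent_limit_adjoint[OF f this]
    show "\<exists>S\<in>{T. \<exists>f. laurent_limit f T}. is_adjoint T S" by blast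
  qed
qed

lemma laurent_limit_of_circle: "laurent_limit of_circle bilateral_shift"
proof -
  have "scale_op 1 (shift_op 1) = bilateral_shift"
    by (rule blinfun_eqI) (simp add: bilateral_shift_def)
  then show ?thesis
    using laurent_pair_limit[OF laurent_pair.mono[of 1 1]] by simp
qed

lemma shift_op_compose: "shift_op m o\<^sub>L shift_op n = shift_op (m + n)"
  by (rule blinfun_eqI) simp

lemma cstar_generated_shift: "cstar_generated bilateral_shift = {T. \<exists>f. laurent_limit f T}"
proof
  show "cstar_generated bilateral_shift \<subseteq> {T. \<exists>f. laurent_limit f T}"
    unfolding cstar_generated_def using laurent_limit_cstar laurent_limit_of_circle by auto
  show "{T. \<exists>f. laurent_limit f T} \<subseteq> cstar_generated bilateral_shift"
    unfolding cstar_generated_def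
  proof (intro Inter_greatest subsetI)
    fix A T assume "A \<in> {A. cstar_subalgebra A \<and> bilateral_shift \<in> A}" and "T \<in> {T. \<exists>f. laurent_limit f T}"
    then obtain f where A: "cstar_subalgebra A" "shift_op 1 \<in> A" and T: "laurent_limit f T"
      by (auto simp: bilateral_shift_def)
    obtain V where "V \<in> A" "is_adjoint (shift_op 1) V"
      using A unfolding cstar_subalgebra_def by blast
    then have m1: "shift_op (- 1) \<in> A"
      using is_adjoint_unique[OF _ is_adjoint_shift[of 1]] by auto
    have mult: "S o\<^sub>L T \<in> A" if "S \<in> A" "T \<in> A" for S T
      using A that unfolding cstar_subalgebra_def by blast
    have sh: "shift_op n \<in> A" for n
    proof (induction n rule: int_induct[where k=0])
      case base
      then show ?case using mult[OF A(2) m1] by (simp add: shift_op_compose)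
    next
      case (step1 i)
      then show ?case using mult[OF step1(2) A(2)] by (simp add: shift_op_compose)
    next
      case (step2 i)
      then show ?case using mult[OF step2(2) m1] by (simp add: shift_op_compose)
    qed
    have P: "S \<in> A" if "laurent_pair g S" for g S
      using that by induction (use A sh in \<open>auto simp: cstar_subalgebra_def\<close>)
    obtain G S where G: "\<And>n. laurent_pair (G n) (S n)" "S \<longlonglongrightarrow> T"
      using T unfolding laurent_limit_def by blast
    have "closed A" using A(1) by (simp add: cstar_subalgebra_def)
    then show "T \<in> A" by (rule closed_sequentially[OF _ P[OF G(1)] G(2)])
  qed
qed

definition laurent_rep :: "(circle \<Rightarrow> complex) \<Rightarrow> (ell2 \<Rightarrow>\<^sub>L ell2)"
  where "laurent_rep = restrict (\<lambda>f. THE T. laurent_limit f T) continuous_functions"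

lemma laurent_rep_iff: "f \<in> continuous_functions \<Longrightarrow> laurent_rep f = T \<longleftrightarrow> laurent_limit f T"
  unfolding laurent_rep_def using laurent_limit_exists[of f] laurent_limit_unique_op
  by (auto intro: theI2 the_equality)

lemma laurent_rep_limit: "f \<in> continuous_functions \<Longrightarrow> laurent_limit f (laurent_rep f)"
  using laurent_rep_iff by blast

lemma continuous_functions_arith:
  assumes "f \<in> continuous_functions" "g \<in> continuous_functions"
  shows "(\<lambda>x. f x + g x) \<in> continuous_functions" "(\<lambda>x. f x * g x) \<in> continuous_functions"
    "(\<lambda>x. c * f x) \<in> continuous_functions"
  using assms by (auto simp: continuous_functions_def intro!: continuous_intros)

lemma star_isomorphism_laurent_rep:
  "star_isomorphism laurent_rep (cstar_generated bilateral_shift)"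
  unfolding star_isomorphism_def
proof (intro conjI ballI allI)
  show "bij_betw laurent_rep continuous_functions (cstar_generated bilateral_shift)"
    unfolding bij_betw_def cstar_generated_shift
  proof
    show "inj_on laurent_rep continuous_functions"
      by (rule inj_onI) (metis laurent_limit_unique_fun laurent_rep_limit)
    show "laurent_rep ` continuous_functions = {T. \<exists>f. laurent_limit f T}"
      using laurent_limit_continuous laurent_rep_iff by (auto simp: image_iff) metis+
  qed
qed (simp_all add: laurent_rep_iff continuous_functions_arith laurent_limit_add laurent_limit_mult
  laurent_limit_scale laurent_rep_limit continuous_functions_cnj
  laurent_limit_adjoint[OF laurent_rep_limit laurent_rep_limit])

lemma star_isomorphism_unique:
  assumes \<Phi>: "star_isomorphism \<Phi> (cstar_generated bilateral_shift)" "\<Phi> of_circle = bilateral_shift"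
    and f: "f \<in> continuous_functions"
  shows "\<Phi> f = laurent_rep f"
proof -
  have bij: "bij_betw \<Phi> continuous_functions (cstar_generated bilateral_shift)"
    and add: "\<And>f g. f \<in> continuous_functions \<Longrightarrow> g \<in> continuous_functions \<Longrightarrow>
      \<Phi> (\<lambda>x. f x + g x) = \<Phi> f + \<Phi> g"
    and mult: "\<And>f g. f \<in> continuous_functions \<Longrightarrow> g \<in> continuous_functions \<Longrightarrow>
      \<Phi> (\<lambda>x. f x * g x) = \<Phi> f o\<^sub>L \<Phi> g"
    and scale: "\<And>f c. f \<in> continuous_functions \<Longrightarrow> \<Phi> (\<lambda>x. c * f x) = scale_op c (\<Phi> f)"
    and adj: "\<And>f. f \<in> continuous_functions \<Longrightarrow> is_adjoint (\<Phi> f) (\<Phi> (\<lambda>x. cnj (f x)))"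
    using \<Phi>(1) unfolding star_isomorphism_def by blast+
  have const: "(\<lambda>_. c) \<in> continuous_functions" for c :: complex
    by (simp add: continuous_functions_def)
  have pow: "(\<lambda>x. of_circle x powi n) \<in> continuous_functions" for n
    by (auto simp: continuous_functions_def intro!: continuous_intros continuous_on_of_circle)
  have one: "\<Phi> (\<lambda>_. 1) = id_blinfun"
  proof -
    have "scalar_op 1 = id_blinfun" by (rule blinfun_eqI) simp
    then have "id_blinfun \<in> cstar_generated bilateral_shift"
      unfolding cstar_generated_shift using laurent_pair_limit[OF laurent_pair_const[of 1]] by auto
    then obtain g where g: "g \<in> continuous_functions" "\<Phi> g = id_blinfun"
      using bij by (metis bij_betw_def imageE)
    have "\<Phi> (\<lambda>_. 1) o\<^sub>L \<Phi> g = \<Phi> (\<lambda>x. 1 * g x)"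
      by (rule mult[OF const g(1), symmetric])
    then have *: "\<Phi> (\<lambda>_. 1) o\<^sub>L id_blinfun = id_blinfun"
      by (simp add: g(2))
    show ?thesis
    proof (rule blinfun_eqI)
      fix x
      show "blinfun_apply (\<Phi> (\<lambda>_. 1)) x = blinfun_apply id_blinfun x"
        using arg_cong[OF *, of "\<lambda>T. blinfun_apply T x"] by simp
    qed
  qed
  have shift: "\<Phi> (\<lambda>x. of_circle x powi n) = shift_op n" for n
  proof (induction n rule: int_induct[where k=0])
    case base
    have "shift_op 0 = id_blinfun" by (rule blinfun_eqI) simp
    then show ?case by (simp add: one)
  next
    case (step1 n)
    have "\<Phi> (\<lambda>x. of_circle x powi n * of_circle x) = shift_op n o\<^sub>L shift_op 1"
      using mult[OF pow[of n] pow[of 1]] step1 \<Phi>(2) by (simp add: bilateral_shift_def)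
    then show ?case by (simp add: power_int_add shift_op_compose)
  next
    case (step2 n)
    have "\<Phi> (\<lambda>x. of_circle x powi (n - 1) * of_circle x) = \<Phi> (\<lambda>x. of_circle x powi (n - 1)) o\<^sub>L shift_op 1"
      using mult[OF pow[of "n - 1"] pow[of 1]] \<Phi>(2) by (simp add: bilateral_shift_def)
    then have *: "shift_op n = \<Phi> (\<lambda>x. of_circle x powi (n - 1)) o\<^sub>L shift_op 1"
      using step2 by (simp add: power_int_diff)
    show ?case
    proof (rule blinfun_eqI)
      fix x
      have "blinfun_apply (shift_op n) (shift_ell2 (- 1) x) = blinfun_apply (\<Phi> (\<lambda>x. of_circle x powi (n - 1))) x"
        by (subst *) simp
      then show "blinfun_apply (\<Phi> (\<lambda>x. of_circle x powi (n - 1))) x = blinfun_apply (shift_op (n - 1)) x"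
        by simp
    qed
  qed
  have cont: "g \<in> continuous_functions" if "laurent_pair g S" for g S
    using laurent_pair_continuous[OF that] by (simp add: continuous_functions_def)
  have pair: "\<Phi> g = S" if "laurent_pair g S" for g S
    using that
  proof induction
    case (mono c n)
    then show ?case using scale[OF pow, of c n] by (simp add: shift)
  next
    case (add f S g T)
    then show ?case using \<open>\<And>f g. _ \<Longrightarrow> _ \<Longrightarrow> \<Phi> (\<lambda>x. f x + g x) = \<Phi> f + \<Phi> g\<close> cont by simp
  qed
  have bound: "norm (\<Phi> g) \<le> M" if g: "g \<in> continuous_functions" and M: "\<And>x. cmod (g x) \<le> M" for g M
  proof (rule norm_blinfun_bound)
    show M0: "M \<ge> 0" using M[of undefined] norm_ge_zero order_trans by blast
    fix x
    define h where "h = (\<lambda>x. complex_of_real (sqrt (M\<^sup>2 - (cmod (g x))\<^sup>2)))"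
    have h: "h \<in> continuous_functions"
      using g unfolding h_def continuous_functions_def by (auto intro!: continuous_intros)
    have cnj: "(\<lambda>x. cnj (g x)) \<in> continuous_functions" by (rule continuous_functions_cnj[OF g])
    have hh: "(\<lambda>x. cnj (h x)) = h" by (simp add: h_def)
    have "(\<lambda>x. cnj (g x) * g x + h x * h x) = (\<lambda>x. of_real (M\<^sup>2) * 1)"
    proof
      fix x
      have "M\<^sup>2 - (cmod (g x))\<^sup>2 \<ge> 0" using M[of x] by (simp add: power_mono)
      then have "h x * h x = of_real (M\<^sup>2 - (cmod (g x))\<^sup>2)"
        unfolding h_def of_real_mult[symmetric] by simp
      moreover have "cnj (g x) * g x = of_real ((cmod (g x))\<^sup>2)"
        by (metis complex_norm_square mult.commute)
      ultimately show "cnj (g x) * g x + h x * h x = of_real (M\<^sup>2) * 1" by simp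
    qed
    then have "(\<Phi> (\<lambda>x. cnj (g x)) o\<^sub>L \<Phi> g) + (\<Phi> h o\<^sub>L \<Phi> h) = scale_op (of_real (M\<^sup>2)) id_blinfun"
      using add[OF continuous_functions_arith(2)[OF cnj g] continuous_functions_arith(2)[OF h h]]
        mult[OF cnj g] mult[OF h h] scale[OF const[of 1], of "of_real (M\<^sup>2)"] one by simp
    then have "blinfun_apply ((\<Phi> (\<lambda>x. cnj (g x)) o\<^sub>L \<Phi> g) + (\<Phi> h o\<^sub>L \<Phi> h)) x = of_real (M\<^sup>2) *\<^sub>C x"
      by simp
    then have "cinner (blinfun_apply (\<Phi> (\<lambda>x. cnj (g x))) (blinfun_apply (\<Phi> g) x)) x +
        cinner (blinfun_apply (\<Phi> h) (blinfun_apply (\<Phi> h) x)) x = of_real (M\<^sup>2) * cinner x x"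
      by (simp add: blinfun.add_left cinner_scaleC_left flip: cinner_add_left)
    then have "cinner (blinfun_apply (\<Phi> g) x) (blinfun_apply (\<Phi> g) x) +
        cinner (blinfun_apply (\<Phi> h) x) (blinfun_apply (\<Phi> h) x) = of_real (M\<^sup>2) * cinner x x"
      using adj[OF g] adj[OF h] unfolding hh is_adjoint_def by simp
    then have "of_real ((norm (blinfun_apply (\<Phi> g) x))\<^sup>2 + (norm (blinfun_apply (\<Phi> h) x))\<^sup>2) =
        complex_of_real (M\<^sup>2 * (norm x)\<^sup>2)"
      unfolding cinner_self norm_ell2_square[symmetric] by simp
    then have "(norm (blinfun_apply (\<Phi> g) x))\<^sup>2 + (norm (blinfun_apply (\<Phi> h) x))\<^sup>2 = M\<^sup>2 * (norm x)\<^sup>2"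
      unfolding of_real_eq_iff .
    then have "(norm (blinfun_apply (\<Phi> g) x))\<^sup>2 \<le> (M * norm x)\<^sup>2"
      using zero_le_power2[of "norm (blinfun_apply (\<Phi> h) x)"] unfolding power_mult_distrib by linarith
    then show "norm (blinfun_apply (\<Phi> g) x) \<le> M * norm x"
      by (rule power2_le_imp_le) (use M0 in simp)
  qed
  obtain G S where G: "\<And>n. laurent_pair (G n) (S n)" "uniform_limit UNIV G f sequentially"
      "S \<longlonglongrightarrow> laurent_rep f"
    using laurent_rep_limit[OF f] unfolding laurent_limit_def by blast
  have "S \<longlonglongrightarrow> \<Phi> f"
  proof (rule LIMSEQ_I)
    fix e :: real assume e: "e > 0"
    obtain N where N: "\<And>n x. n \<ge> N \<Longrightarrow> dist (G n x) (f x) < e/2"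
      using uniform_limitD[OF G(2), of "e/2"] e by (auto simp: eventually_sequentially)
    have "norm (S n - \<Phi> f) < e" if n: "n \<ge> N" for n
    proof -
      have mf: "(\<lambda>x. - 1 * f x) \<in> continuous_functions"
        by (rule continuous_functions_arith(3)[OF f f])
      have "scale_op (- 1) (\<Phi> f) = - \<Phi> f"
        by (rule blinfun_eqI) (auto intro!: ell2_eqI simp: blinfun.minus_left)
      then have "\<Phi> (\<lambda>x. G n x + - 1 * f x) = S n - \<Phi> f"
        using add[OF cont[OF G(1)] mf] scale[OF f, of "- 1"] pair[OF G(1)] by simp
      moreover have "norm (\<Phi> (\<lambda>x. G n x + - 1 * f x)) \<le> e/2"
        using N[OF n] by (intro bound continuous_functions_arith(1)[OF cont[OF G(1)] mf])
          (simp add: dist_norm less_imp_le)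
      ultimately show ?thesis using e by simp
    qed
    then show "\<exists>N. \<forall>n\<ge>N. norm (S n - \<Phi> f) < e" by blast
  qed
  with G(3) show ?thesis by (rule LIMSEQ_unique[rotated])
qed

theorem circle_rep_ex1:
  "\<exists>!\<Phi>. \<Phi> \<in> extensional continuous_functions \<and>
    star_isomorphism \<Phi> (cstar_generated bilateral_shift) \<and> \<Phi> of_circle = bilateral_shift"
proof (rule ex1I)
  show *: "laurent_rep \<in> extensional continuous_functions \<and>
      star_isomorphism laurent_rep (cstar_generated bilateral_shift) \<and> laurent_rep of_circle = bilateral_shift"
    using star_isomorphism_laurent_rep laurent_limit_of_circle
      laurent_rep_iff[OF laurent_limit_continuous[OF laurent_limit_of_circle]]
    by (simp add: laurent_rep_def)
  fix \<Phi>
  assume \<Phi>: "\<Phi> \<in> extensional continuous_functions \<and>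
    star_isomorphism \<Phi> (cstar_generated bilateral_shift) \<and> \<Phi> of_circle = bilateral_shift"
  show "\<Phi> = laurent_rep"
    by (rule extensionalityI[where A=continuous_functions])
      (use \<Phi> * star_isomorphism_unique in auto)
qed

lemma circle_rep:
  "circle_rep \<in> extensional continuous_functions"
  "star_isomorphism circle_rep (cstar_generated bilateral_shift)"
  "circle_rep of_circle = bilateral_shift"
  using theI'[OF circle_rep_ex1] unfolding circle_rep_def[symmetric] by auto

lemma is_q_derivative_unique:
  assumes "is_q_derivative q T S" "is_q_derivative q T S'"
  shows "S = S'"
proof -
  have col: "blinfun_apply S (basis_vec k) = blinfun_apply S' (basis_vec k)" for k
    using assms by (intro ell2_eqI) (simp add: is_q_derivative_def matrix_entry_def flip: cinner_basis)
  have SB: "S \<in> bounded_ops" "S' \<in> bounded_ops"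
    using assms by (auto simp: is_q_derivative_def)
  have fin: "blinfun_apply S y = blinfun_apply S' y" if y: "fourier_transform y F" for y F
  proof -
    obtain A where A: "finite A" "\<And>j. j \<notin> A \<Longrightarrow> coord y j = 0"
      using y unfolding fourier_transform_def by blast
    have coord_sum: "coord (sum g B) j = (\<Sum>i\<in>B. coord (g i) j)" for g :: "int \<Rightarrow> ell2" and B j
      by (induction B rule: infinite_finite_induct) auto
    have "y = (\<Sum>j\<in>A. coord y j *\<^sub>C basis_vec j)"
      by (rule ell2_eqI) (use A in \<open>auto simp: coord_sum coord_basis_vec if_distrib cong: if_cong\<close>)
    moreover have "blinfun_apply S (\<Sum>j\<in>A. coord y j *\<^sub>C basis_vec j) =
        blinfun_apply S' (\<Sum>j\<in>A. coord y j *\<^sub>C basis_vec j)"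
      using SB by (simp add: blinfun.sum_right bounded_ops_def col)
    ultimately show ?thesis by simp
  qed
  have "\<exists>y F. fourier_transform y F \<and> norm (x - y) \<le> 1 / Suc n" for x and n :: nat
    by (rule finite_support_dense) simp
  then obtain Y where Y: "\<And>x n. \<exists>F. fourier_transform (Y x n) F" "\<And>x n. norm (x - Y x n) \<le> 1 / Suc n"
    by metis
  show ?thesis
  proof (rule blinfun_eqI)
    fix x
    have "(\<lambda>n. Y x n) \<longlonglongrightarrow> x"
    proof (rule Lim_null[THEN iffD2], rule Lim_null_comparison)
      show "\<forall>\<^sub>F n in sequentially. norm (Y x n - x) \<le> inverse (real (Suc n))"
        using Y(2)[of x] by (simp add: norm_minus_commute inverse_eq_divide)
    qed (rule LIMSEQ_inverse_real_of_nat)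
    then have "(\<lambda>n. blinfun_apply S (Y x n)) \<longlonglongrightarrow> blinfun_apply S x"
        "(\<lambda>n. blinfun_apply S' (Y x n)) \<longlonglongrightarrow> blinfun_apply S' x"
      by (intro blinfun.tendsto tendsto_const; assumption)+
    moreover have "blinfun_apply S (Y x n) = blinfun_apply S' (Y x n)" for n
      using fin Y(1)[of x n] by blast
    ultimately show "blinfun_apply S x = blinfun_apply S' x"
      by (simp add: LIMSEQ_unique)
  qed
qed

end

theory Submission
  imports Defs
begin

text \<open>A Lipschitz seminorm with respect to a metric satisfies the Leibniz inequality, so squaring
  a function of modulus at most one increases its Lipschitz constant at most by a factor of two
  (\<open>lipschitz_const_mult_le\<close>). The seminorm \<open>L_q\<close> violates this already at the coordinate
  function \<open>z\<close>. Indeed \<open>z\<^sup>n\<close> acts as the \<open>n\<close>-th power of the bilateral shift, whose matrix is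
  supported on the single diagonal \<open>j - k = n\<close>. There the \<open>q\<close>-derivative is multiplication by
  the constant \<open>\<i> [n]\<^sub>q\<close>, and hence \<open>L_q (z\<^sup>n) = \<bar>[n]\<^sub>q\<bar>\<close> (\<open>L_q_shift_op\<close>). But
  \<open>[1]\<^sub>q = 1\<close>, whereas \<open>[2]\<^sub>q = q + 1 / q > 2\<close> because \<open>q \<noteq> 1\<close>.\<close>

lemma lipschitz_const_bound:
  assumes \<rho>: "\<And>x y. 0 \<le> \<rho> x y" and f: "f \<in> Lip \<rho>"
  shows "0 \<le> lipschitz_const \<rho> f"
    and "cmod (f x - f y) \<le> lipschitz_const \<rho> f * \<rho> x y"
proof -
  let ?K = "{C. 0 \<le> C \<and> (\<forall>x y. cmod (f x - f y) \<le> C * \<rho> x y)}"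
  obtain C where C: "\<And>x y. cmod (f x - f y) \<le> C * \<rho> x y"
    using f unfolding Lip_def by blast
  have "cmod (f x - f y) \<le> max 0 C * \<rho> x y" for x y
    by (rule order_trans[OF C mult_right_mono[OF _ \<rho>]]) simp
  then have ne: "?K \<noteq> {}"
    by (auto intro!: exI[of _ "max 0 C"])
  then show "0 \<le> lipschitz_const \<rho> f"
    unfolding lipschitz_const_def by (intro cInf_greatest) auto
  show "cmod (f x - f y) \<le> lipschitz_const \<rho> f * \<rho> x y"
  proof (cases "\<rho> x y = 0")
    case True
    then show ?thesis using C[of x y] by simp
  next
    case False
    then have pos: "0 < \<rho> x y" using \<rho>[of x y] by simp
    have "cmod (f x - f y) / \<rho> x y \<le> lipschitz_const \<rho> f"
      unfolding lipschitz_const_def by (rule cInf_greatest[OF ne]) (use pos in \<open>auto simp: field_simps\<close>)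
    with pos show ?thesis by (simp add: field_simps)
  qed
qed

lemma lipschitz_const_le:
  assumes "0 \<le> C" "\<And>x y. cmod (f x - f y) \<le> C * \<rho> x y"
  shows "lipschitz_const \<rho> f \<le> C"
  unfolding lipschitz_const_def by (rule cInf_lower) (use assms in auto)

text \<open>The Leibniz inequality, from
  \<open>f x * g x - f y * g y = f x * (g x - g y) + (f x - f y) * g y\<close>.\<close>

lemma lipschitz_const_mult_le:
  assumes \<rho>: "\<And>x y. 0 \<le> \<rho> x y" and f: "f \<in> Lip \<rho>" and g: "g \<in> Lip \<rho>"
    and A: "\<And>x. cmod (f x) \<le> A" and B: "\<And>x. cmod (g x) \<le> B"
  shows "lipschitz_const \<rho> (\<lambda>x. f x * g x) \<le> A * lipschitz_const \<rho> g + lipschitz_const \<rho> f * B"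
proof (rule lipschitz_const_le)
  have A0: "0 \<le> A" using A[of undefined] norm_ge_zero order_trans by blast
  have B0: "0 \<le> B" using B[of undefined] norm_ge_zero order_trans by blast
  note Lf = lipschitz_const_bound[of \<rho> f, OF \<rho> f] and Lg = lipschitz_const_bound[of \<rho> g, OF \<rho> g]
  show "0 \<le> A * lipschitz_const \<rho> g + lipschitz_const \<rho> f * B"
    using A0 B0 Lf(1) Lg(1) by simp
  fix x y
  have "cmod (f x * g x - f y * g y) = cmod (f x * (g x - g y) + (f x - f y) * g y)"
    by (simp add: algebra_simps)
  also have "\<dots> \<le> cmod (f x) * cmod (g x - g y) + cmod (f x - f y) * cmod (g y)"
    using norm_triangle_ineq[of "f x * (g x - g y)" "(f x - f y) * g y"] by (simp add: norm_mult)
  also have "\<dots> \<le> A * (lipschitz_const \<rho> g * \<rho> x y) + (lipschitz_const \<rho> f * \<rho> x y) * B"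
    by (intro add_mono mult_mono A B Lf(2) Lg(2) A0 mult_nonneg_nonneg Lf(1) \<rho>) simp_all
  finally show "cmod (f x * g x - f y * g y)
      \<le> (A * lipschitz_const \<rho> g + lipschitz_const \<rho> f * B) * \<rho> x y"
    by (simp add: algebra_simps)
qed

lemma circle_rep_power: "circle_rep (\<lambda>x. of_circle x powi n) = shift_op n"
proof -
  have "scale_op 1 (shift_op n) = shift_op n"
    by (rule blinfun_eqI) simp
  then have lim: "laurent_limit (\<lambda>x. of_circle x powi n) (shift_op n)"
    using laurent_pair_limit[OF laurent_pair.mono[of 1 n]] by simp
  note cont = laurent_limit_continuous[OF lim]
  then show ?thesis
    using star_isomorphism_unique[OF circle_rep(2,3) cont] laurent_rep_iff[OF cont] lim by simp
qed

lemma norm_scale_shift: "norm (scale_op c (shift_op n)) = cmod c"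
proof (rule antisym)
  show "norm (scale_op c (shift_op n)) \<le> cmod c"
    by (rule laurent_pair_norm_le[OF laurent_pair.mono]) (simp add: norm_mult norm_power_int)
  show "cmod c \<le> norm (scale_op c (shift_op n))"
    using laurent_pair_norm_ge[where w = undefined, OF laurent_pair.mono[of c n]]
    by (simp add: norm_mult norm_power_int)
qed

text \<open>The matrix of \<open>shift_op n\<close> vanishes off the diagonal \<open>j - k = n\<close>, so the entrywise factor
  \<open>\<i> [j - k]\<^sub>q\<close> may be replaced by the constant \<open>\<i> [n]\<^sub>q\<close>.\<close>

lemma is_q_derivative_shift_op:
  "is_q_derivative q (shift_op n) (scale_op (\<i> * of_real (q_int q n)) (shift_op n))"
  unfolding is_q_derivative_def matrix_entry_def cinner_basis
  using laurent_pair_bounded_ops[OF laurent_pair.mono]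
  by (auto simp: coord_basis_vec)

lemma L_q_shift_op: "L_q q (shift_op n) = \<bar>q_int q n\<bar>"
proof -
  have "q_derivative q (shift_op n) = scale_op (\<i> * of_real (q_int q n)) (shift_op n)"
    unfolding q_derivative_def using is_q_derivative_shift_op is_q_derivative_unique
    by (blast intro: the_equality)
  then show ?thesis by (simp add: L_q_def norm_scale_shift norm_mult)
qed

lemma q_int_1:
  assumes "0 < q" "q < 1"
  shows "q_int q 1 = 1"
proof -
  have "1 < inverse q" using assms by (rule one_less_inverse)
  then have "q - inverse q \<noteq> 0" using assms by linarith
  then show ?thesis by (simp add: q_int_def power_int_minus)
qed

lemma q_int_2_gt:
  assumes "0 < q" "q < 1"
  shows "2 < q_int q 2"
proof -
  have "1 < inverse q" using assms by (rule one_less_inverse)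
  then have nz: "q - inverse q \<noteq> 0" using assms by linarith
  have "q powi 2 - q powi (- 2) = (q - inverse q) * (q + inverse q)"
    by (simp add: power_int_minus power2_eq_square algebra_simps)
  then have eq: "q_int q 2 = q + inverse q"
    using nz by (simp add: q_int_def)
  have "0 < (1 - q)\<^sup>2 * inverse q" using assms by simp
  also have "(1 - q)\<^sup>2 * inverse q = q + inverse q - 2"
    using assms by (simp add: power2_eq_square field_simps)
  finally show ?thesis using eq by simp
qed

theorem proposition6p16:
  fixes q :: real and X :: "(ell2 \<Rightarrow>\<^sub>L ell2) set"
  assumes "0 < q" and "q < 1"
    and "operator_subsystem X (Lip_q_circle q)"
    and "circle_rep ` laurent_polynomials \<subseteq> X"
  shows "\<not> (\<exists>\<rho> :: circle \<Rightarrow> circle \<Rightarrow> real. compatible_metric \<rho> \<and>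
    comes_from_metric {f \<in> continuous_functions. circle_rep f \<in> X} (\<lambda>f. L_q q (circle_rep f)) \<rho>)"
proof
  assume "\<exists>\<rho> :: circle \<Rightarrow> circle \<Rightarrow> real. compatible_metric \<rho> \<and>
    comes_from_metric {f \<in> continuous_functions. circle_rep f \<in> X} (\<lambda>f. L_q q (circle_rep f)) \<rho>"
  then obtain \<rho> :: "circle \<Rightarrow> circle \<Rightarrow> real" where met: "Metric_space UNIV \<rho>"
    and comes: "comes_from_metric {f \<in> continuous_functions. circle_rep f \<in> X}
      (\<lambda>f. L_q q (circle_rep f)) \<rho>"
    unfolding compatible_metric_def by blast
  have \<rho>: "0 \<le> \<rho> x y" for x y
    using met by (rule Metric_space.nonneg)
  let ?z = "\<lambda>n x. of_circle x powi n"
  have z: "?z n \<in> {f \<in> continuous_functions. circle_rep f \<in> X}" for n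
  proof -
    have "?z n \<in> laurent_polynomials"
      unfolding laurent_polynomials_def by (auto intro!: exI[of _ "{n}"] exI[of _ "\<lambda>_. 1"])
    moreover have "?z n \<in> continuous_functions"
      by (auto simp: continuous_functions_def intro!: continuous_intros continuous_on_of_circle)
    ultimately show ?thesis using assms(4) by blast
  qed
  have Lip: "?z n \<in> Lip \<rho>" for n
    using comes z[of n] unfolding comes_from_metric_def by blast
  have const: "lipschitz_const \<rho> (?z n) = \<bar>q_int q n\<bar>" for n
  proof -
    have "L_q q (circle_rep (?z n)) = lipschitz_const \<rho> (?z n)"
      using comes z[of n] unfolding comes_from_metric_def by blast
    then show ?thesis by (simp add: circle_rep_power L_q_shift_op)
  qed
  have "?z 2 = (\<lambda>x. ?z 1 x * ?z 1 x)"
    by (simp add: power2_eq_square)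
  then have "lipschitz_const \<rho> (?z 2) \<le> 2 * lipschitz_const \<rho> (?z 1)"
    using lipschitz_const_mult_le[of \<rho>, OF \<rho> Lip[of 1] Lip[of 1], of 1 1] by simp
  then show False
    using const[of 1] const[of 2] q_int_1[OF assms(1,2)] q_int_2_gt[OF assms(1,2)] by simp
qed

end
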